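(* Let $\boldsymbol{M}$ be the Polish space of all infinite minimal subshifts with some finite alphabet $\mathsf{A}\subseteq\mathbb{Z}$. The subset of $\boldsymbol{M}$ consisting of all strong Toeplitz subshifts of rank $2$ is generic in $\boldsymbol{M}$.
   Context: **Subshifts.** For a finite alphabet $\mathsf{A}$, $S$ is the shift on $\mathsf{A}^{\mathbb{Z}}$, $S(x)(i)=x(i+1)$. A subshift is a closed set $X\subseteq\mathsf{A}^{\mathbb{Z}}$ with $S(X)=X$; it is minimal if every $S$-orbit is dense. Subshifts $X,Y$ are conjugate if there is a homeomorphism $\varphi\colon X\to Y$ with $\varphi\circ S=S\circ\varphi$. **The space.** Let $\boldsymbol{S}$ be the space of all subshifts with some finite alphabet $\mathsf{A}\subseteq\mathbb{Z}$, with metric $d(X,Y)=2^{-\inf\{n\,:\,L_n(X)\neq L_n(Y)\}}$, where $L_n(X)$ is the set of words of length $n$ occurring in elements of $X$. It is Polish, and $\boldsymbol{M}\subseteq\boldsymbol{S}$, the set of infinite minimal subshifts with the subspace topology, is a $G_\delta$ subset, hence Polish. A subset of a Polish space is generic if it contains a dense $G_\delta$ subset. **Strong Toeplitz subshifts.** A morphism $\tau\colon A^*\to B^*$ between sets of finite words over finite alphabets satisfies $\tau(uv)=\tau(u)\tau(v)$; all morphisms are non-erasing ($\tau(a)$ is nonempty for all $a\in A$). For $y\in A^{\mathbb{Z}}$, $\tau(y)=\cdots\tau(y(-1)).\tau(y(0))\tau(y(1))\cdots$, where the dot marks that position $0$ is the start of $\tau(y(0))$. A directive sequence is a sequence of morphisms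 $\boldsymbol{\tau}=(\tau_n\colon A_{n+1}^*\to A_n^* )_{n\geq0}$; put $\tau_{[n,N)}=\tau_n\circ\cdots\circ\tau_{N-1}$. $X^{(n)}_{\boldsymbol{\tau}}$ is the set of $x\in A_n^{\mathbb{Z}}$ such that every finite subword of $x$ occurs in $\tau_{[n,N)}(a)$ for some $N>n$, $a\in A_N$; $X_{\boldsymbol{\tau}}=X^{(0)}_{\boldsymbol{\tau}}$ is the $\mathcal{S}$-adic subshift generated by $\boldsymbol{\tau}$. The alphabet rank of $\boldsymbol{\tau}$ is $\liminf_n|A_n|$. $\boldsymbol{\tau}$ is: constant-length if for each $n$, $|\tau_n(a)|$ does not depend on $a\in A_{n+1}$; primitive if for every $n$ there is $N>n$ such that all letters of $A_n$ occur in $\tau_{[n,N)}(a)$ for all $a\in A_N$; proper if for each $n$ all words $\tau_n(a)$, $a\in A_{n+1}$, start with the same letter and end with the same letter; recognizable if for each $n$ every $x\in A_n^{\mathbb{Z}}$ admits at most one pair $(y,k)$ with $y\in X^{(n+1)}_{\boldsymbol{\tau}}$, $0\leq k<|\tau_n(y(0))|$ and $x=S^k\tau_n(y)$. For $K\geq2$, a strong Toeplitz subshift of rank $K$ is a subshift conjugate to an $\mathcal{S}$-adic subshift generated by a constant-length, primitive, proper and recognizable directive sequence of alphabet rank $k\leq K$. *)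

theory Defs
  imports "HOL-Analysis.Analysis" "HOL-Library.Sublist" "HOL-Library.Extended_Nat"
begin

text \<open>
  Two-sided sequences are functions of type \<^typ>\<open>int \<Rightarrow> int\<close>: the first \<^typ>\<open>int\<close> is the index set, the
  second contains all alphabets. Topological notions on this type refer to the library's product
  topology of the discrete topology on \<^typ>\<open>int\<close>. A full shift over a finite alphabet is closed in it,
  so its relative topology is the usual one.
\<close>

section \<open>Subshifts\<close>

definition full_shift :: "int set \<Rightarrow> (int \<Rightarrow> int) set" where
  "full_shift A = {x. range x \<subseteq> A}"

definition shift :: "(int \<Rightarrow> int) \<Rightarrow> (int \<Rightarrow> int)" where
  "shift x = (\<lambda>i. x (i + 1))"

text \<open>The two-sided orbit: \<^term>\<open>\<lambda>i. x (i + k)\<close> is the \<open>k\<close>-th power of the shift applied to \<open>x\<close>,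
  for any integer \<open>k\<close>.\<close>

definition shift_orbit :: "(int \<Rightarrow> int) \<Rightarrow> (int \<Rightarrow> int) set" where
  "shift_orbit x = {\<lambda>i. x (i + k) | k. True}"

definition subshifts :: "(int \<Rightarrow> int) set set" where
  "subshifts = {X. closed X \<and> shift ` X = X \<and> (\<exists>A. finite A \<and> X \<subseteq> full_shift A)}"

definition minimal_subshift :: "(int \<Rightarrow> int) set \<Rightarrow> bool" where
  "minimal_subshift X \<longleftrightarrow> X \<in> subshifts \<and> (\<forall>x\<in>X. X \<subseteq> closure (shift_orbit x))"

definition conjugate_subshifts :: "(int \<Rightarrow> int) set \<Rightarrow> (int \<Rightarrow> int) set \<Rightarrow> bool" where
  "conjugate_subshifts X Y \<longleftrightarrow>
     (\<exists>\<phi> \<psi>. homeomorphism X Y \<phi> \<psi> \<and> (\<forall>x\<in>X. \<phi> (shift x) = shift (\<phi> x)))"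

section \<open>The space of subshifts\<close>

definition window :: "(int \<Rightarrow> int) \<Rightarrow> int \<Rightarrow> nat \<Rightarrow> int list" where
  "window x i n = map (\<lambda>j. x (i + int j)) [0..<n]"

definition language :: "nat \<Rightarrow> (int \<Rightarrow> int) set \<Rightarrow> int list set" where
  "language n X = {window x i n | x i. x \<in> X}"

text \<open>The first case is the convention that the infimum of the empty set is infinite; on \<^typ>\<open>nat\<close> the
  library has \<^prop>\<open>Inf {} = (0::nat)\<close>.\<close>

definition subshift_dist :: "(int \<Rightarrow> int) set \<Rightarrow> (int \<Rightarrow> int) set \<Rightarrow> real" where
  "subshift_dist X Y =
     (if \<forall>n. language n X = language n Y then 0
      else (1/2) ^ Inf {n. language n X \<noteq> language n Y})"

definition subshift_space :: "(int \<Rightarrow> int) set topology" where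
  "subshift_space = Metric_space.mtopology subshifts subshift_dist"

definition infinite_minimal_subshifts :: "(int \<Rightarrow> int) set set" where
  "infinite_minimal_subshifts = {X. minimal_subshift X \<and> infinite X}"

definition infinite_minimal_space :: "(int \<Rightarrow> int) set topology" where
  "infinite_minimal_space = subtopology subshift_space infinite_minimal_subshifts"

definition generic_in :: "'a topology \<Rightarrow> 'a set \<Rightarrow> bool" where
  "generic_in T B \<longleftrightarrow>
     B \<subseteq> topspace T \<and> (\<exists>G. gdelta_in T G \<and> T closure_of G = topspace T \<and> G \<subseteq> B)"

lemma length_window [simp]: "length (window x i n) = n"
  by (simp add: window_def)

lemma nth_window [simp]: "j < n \<Longrightarrow> window x i n ! j = x (i + int j)"
  by (simp add: window_def)

lemma in_subshift_if_windows:
  assumes X: "X \<in> subshifts" and w: "\<And>i n. window x i n \<in> language n X"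
  shows "x \<in> X"
proof -
  have sh: "(\<lambda>i. y (i + k)) \<in> X" if "y \<in> X" for y and k :: int
  proof (induction k rule: int_induct[where k = 0])
    case base then show ?case using that by simp
  next
    case (step1 i)
    then have "shift (\<lambda>j. y (j + i)) \<in> X" using X by (auto simp: subshifts_def)
    then show ?case by (simp add: shift_def algebra_simps)
  next
    case (step2 i)
    then obtain z where z: "z \<in> X" "(\<lambda>j. y (j + i)) = shift z"
      using X unfolding subshifts_def by blast
    have "z j = y (j + (i - 1))" for j
      using fun_cong[OF z(2), of "j - 1"] by (simp add: shift_def algebra_simps)
    then have "z = (\<lambda>j. y (j + (i - 1)))" by blast
    then show ?case using z by simp
  qed
  have ex: "\<exists>y\<in>X. \<forall>i. \<bar>i\<bar> \<le> int n \<longrightarrow> y i = x i" for n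
  proof -
    obtain y k where y: "y \<in> X" "window x (- int n) (2*n+1) = window y k (2*n+1)"
      using w[of "- int n" "2*n+1"] unfolding language_def by blast
    have "y (i + (k + int n)) = x i" if "\<bar>i\<bar> \<le> int n" for i
    proof -
      have "nat (i + int n) < 2*n+1" using that by linarith
      then have "x (- int n + int (nat (i + int n))) = y (k + int (nat (i + int n)))"
        by (metis nth_window y(2))
      moreover have "- int n + int (nat (i + int n)) = i"
        "k + int (nat (i + int n)) = i + (k + int n)" using that by linarith+
      ultimately show ?thesis by metis
    qed
    then show ?thesis
      by (intro bexI[OF _ sh[OF y(1), of "k + int n"]]) simp
  qed
  then have "\<forall>n. \<exists>y. y \<in> X \<and> (\<forall>i. \<bar>i\<bar> \<le> int n \<longrightarrow> y i = x i)" by blast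
  from choice[OF this] obtain f
    where "\<forall>n. f n \<in> X \<and> (\<forall>i. \<bar>i\<bar> \<le> int n \<longrightarrow> f n i = x i)" ..
  then have f: "\<And>n. f n \<in> X" "\<And>n i. \<bar>i\<bar> \<le> int n \<Longrightarrow> f n i = x i" by simp_all
  have "((\<lambda>n. f n i) \<longlongrightarrow> x i) sequentially" for i
  proof (rule tendsto_eventually)
    show "\<forall>\<^sub>F n in sequentially. f n i = x i"
    proof (rule eventually_sequentiallyI)
      fix n assume "nat \<bar>i\<bar> \<le> n"
      then have "\<bar>i\<bar> \<le> int n" by linarith
      then show "f n i = x i" by (rule f(2))
    qed
  qed
  then have "f \<longlonglongrightarrow> x"
    using limitin_componentwise[of "\<lambda>_. euclidean" UNIV f x sequentially]
    by (simp add: euclidean_product_topology)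
  then show ?thesis
    using X f(1) closed_sequentially[of X f x] by (auto simp: subshifts_def)
qed

lemma subshift_eqI:
  assumes "X \<in> subshifts" "Y \<in> subshifts" "\<And>n. language n X = language n Y"
  shows "X = Y"
proof -
  have "Z \<subseteq> W" if "W \<in> subshifts" "\<And>n. language n Z = language n W" for Z W
  proof
    fix x assume "x \<in> Z"
    then have "window x i n \<in> language n Z" for i n by (auto simp: language_def)
    then show "x \<in> W" using in_subshift_if_windows that by blast
  qed
  then show ?thesis using assms by blast
qed

lemma Metric_space_subshifts: "Metric_space subshifts subshift_dist"
proof
  fix X Y :: "(int \<Rightarrow> int) set"
  show "0 \<le> subshift_dist X Y" by (simp add: subshift_dist_def)
  show "subshift_dist X Y = subshift_dist Y X"
  proof -
    have "(\<lambda>n. language n X = language n Y) = (\<lambda>n. language n Y = language n X)"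
      by (rule ext, rule eq_commute)
    then show ?thesis unfolding subshift_dist_def by metis
  qed
  show "subshift_dist X Y = 0 \<longleftrightarrow> X = Y" if "X \<in> subshifts" "Y \<in> subshifts"
    using subshift_eqI[OF that] by (auto simp: subshift_dist_def)
next
  fix X Y Z :: "(int \<Rightarrow> int) set"
  show "subshift_dist X Z \<le> subshift_dist X Y + subshift_dist Y Z"
  proof (cases "\<forall>n. language n X = language n Z")
    case True
    then show ?thesis by (simp add: subshift_dist_def)
  next
    case False
    define k where "k = Inf {n. language n X \<noteq> language n Z}"
    have kk: "language k X \<noteq> language k Z"
      unfolding k_def using Inf_nat_def1[of "{n. language n X \<noteq> language n Z}"] False by auto
    have d: "subshift_dist X Z = (1/2) ^ k" using False by (simp add: subshift_dist_def k_def)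
    have ge: "subshift_dist U W \<ge> (1/2) ^ k" if "language k U \<noteq> language k W" for U W
      using that by (auto simp: subshift_dist_def intro!: power_decreasing cInf_lower)
    have nn: "subshift_dist U W \<ge> 0" for U W by (simp add: subshift_dist_def)
    have "language k X \<noteq> language k Y \<or> language k Y \<noteq> language k Z" using kk by metis
    then show ?thesis
    proof
      assume "language k X \<noteq> language k Y"
      then show ?thesis using ge[of X Y] nn[of Y Z] d by linarith
    next
      assume "language k Y \<noteq> language k Z"
      then show ?thesis using ge[of Y Z] nn[of X Y] d by linarith
    qed
  qed
qed

lemma topspace_infinite_minimal_space:
  "topspace infinite_minimal_space = infinite_minimal_subshifts"
proof -
  have "infinite_minimal_subshifts \<subseteq> subshifts"
    unfolding infinite_minimal_subshifts_def minimal_subshift_def by blast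
  then show ?thesis
    unfolding infinite_minimal_space_def subshift_space_def topspace_subtopology
      Metric_space.topspace_mtopology[OF Metric_space_subshifts] by blast
qed

section \<open>Directive sequences\<close>

text \<open>Morphisms are non-erasing throughout; only their values on words over the domain alphabet matter.\<close>

definition word_morphism :: "int set \<Rightarrow> int set \<Rightarrow> (int list \<Rightarrow> int list) \<Rightarrow> bool" where
  "word_morphism A B \<tau> \<longleftrightarrow>
     (\<forall>u\<in>lists A. \<tau> u \<in> lists B) \<and>
     (\<forall>u\<in>lists A. \<forall>v\<in>lists A. \<tau> (u @ v) = \<tau> u @ \<tau> v) \<and>
     (\<forall>a\<in>A. \<tau> [a] \<noteq> [])"

text \<open>The sequence \<open>\<tau>(y)\<close>: as \<open>\<tau>\<close> is non-erasing, the entry at a position \<open>i \<ge> 0\<close> is found in the image of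
  \<open>y(0) \<dots> y(i)\<close>, which starts at position \<open>0\<close>, and the entry at \<open>i < 0\<close> in the image of
  \<open>y(i) \<dots> y(-1)\<close>, which ends at position \<open>-1\<close>.\<close>

definition morphism_seq :: "(int list \<Rightarrow> int list) \<Rightarrow> (int \<Rightarrow> int) \<Rightarrow> (int \<Rightarrow> int)" where
  "morphism_seq \<tau> y i =
     (if 0 \<le> i then \<tau> (window y 0 (nat i + 1)) ! nat i
      else rev (\<tau> (window y i (nat (- i)))) ! nat (- i - 1))"

definition directive_sequence :: "(nat \<Rightarrow> int set) \<Rightarrow> (nat \<Rightarrow> int list \<Rightarrow> int list) \<Rightarrow> bool" where
  "directive_sequence A \<tau> \<longleftrightarrow>
     (\<forall>n. finite (A n)) \<and> (\<forall>n. word_morphism (A (Suc n)) (A n) (\<tau> n))"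

definition block_morphism :: "(nat \<Rightarrow> int list \<Rightarrow> int list) \<Rightarrow> nat \<Rightarrow> nat \<Rightarrow> int list \<Rightarrow> int list" where
  "block_morphism \<tau> n N = foldr (\<circ>) (map \<tau> [n..<N]) id"

definition sadic_subshift ::
    "(nat \<Rightarrow> int set) \<Rightarrow> (nat \<Rightarrow> int list \<Rightarrow> int list) \<Rightarrow> nat \<Rightarrow> (int \<Rightarrow> int) set" where
  "sadic_subshift A \<tau> n =
     {x \<in> full_shift (A n). \<forall>i l. \<exists>N>n. \<exists>a\<in>A N. sublist (window x i l) (block_morphism \<tau> n N [a])}"

definition alphabet_rank :: "(nat \<Rightarrow> int set) \<Rightarrow> enat" where
  "alphabet_rank A = liminf (\<lambda>n. enat (card (A n)))"

definition constant_length_seq :: "(nat \<Rightarrow> int set) \<Rightarrow> (nat \<Rightarrow> int list \<Rightarrow> int list) \<Rightarrow> bool" where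
  "constant_length_seq A \<tau> \<longleftrightarrow>
     (\<forall>n. \<forall>a\<in>A (Suc n). \<forall>b\<in>A (Suc n). length (\<tau> n [a]) = length (\<tau> n [b]))"

definition primitive_seq :: "(nat \<Rightarrow> int set) \<Rightarrow> (nat \<Rightarrow> int list \<Rightarrow> int list) \<Rightarrow> bool" where
  "primitive_seq A \<tau> \<longleftrightarrow> (\<forall>n. \<exists>N>n. \<forall>a\<in>A N. A n \<subseteq> set (block_morphism \<tau> n N [a]))"

definition proper_seq :: "(nat \<Rightarrow> int set) \<Rightarrow> (nat \<Rightarrow> int list \<Rightarrow> int list) \<Rightarrow> bool" where
  "proper_seq A \<tau> \<longleftrightarrow>
     (\<forall>n. \<forall>a\<in>A (Suc n). \<forall>b\<in>A (Suc n).
        hd (\<tau> n [a]) = hd (\<tau> n [b]) \<and> last (\<tau> n [a]) = last (\<tau> n [b]))"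

definition recognizable_seq :: "(nat \<Rightarrow> int set) \<Rightarrow> (nat \<Rightarrow> int list \<Rightarrow> int list) \<Rightarrow> bool" where
  "recognizable_seq A \<tau> \<longleftrightarrow>
     (\<forall>n. \<forall>x\<in>full_shift (A n).
        Uniq (\<lambda>(y, k). y \<in> sadic_subshift A \<tau> (Suc n) \<and> k < length (\<tau> n [y 0]) \<and>
                       x = (shift ^^ k) (morphism_seq (\<tau> n) y)))"

text \<open>Any finite alphabets can be renamed to subsets of \<^typ>\<open>int\<close>, so quantifying over integer alphabets
  loses no directive sequence up to conjugacy.\<close>

definition strong_toeplitz :: "nat \<Rightarrow> (int \<Rightarrow> int) set \<Rightarrow> bool" where
  "strong_toeplitz K X \<longleftrightarrow>
     X \<in> subshifts \<and>
     (\<exists>A \<tau>. directive_sequence A \<tau> \<and> constant_length_seq A \<tau> \<and> primitive_seq A \<tau> \<and>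
        proper_seq A \<tau> \<and> recognizable_seq A \<tau> \<and> alphabet_rank A \<le> enat K \<and>
        conjugate_subshifts X (sadic_subshift A \<tau> 0))"

lemma length_morphism_ge:
  assumes m: "word_morphism A B \<tau>" and u: "u \<in> lists A"
  shows "length u \<le> length (\<tau> u)"
  using u
proof (induction u)
  case (Cons a u)
  have "[a] \<in> lists A" using Cons.hyps by simp
  then have "\<tau> ([a] @ u) = \<tau> [a] @ \<tau> u"
    using m Cons.hyps(2) unfolding word_morphism_def by blast
  moreover have "\<tau> [a] \<noteq> []" using m Cons.hyps by (auto simp: word_morphism_def)
  ultimately show ?case using Cons.IH by (cases "\<tau> [a]") auto
qed simp

lemma window_add: "window y i (m + n) = window y i m @ window y (i + int m) n"
proof (rule nth_equalityI)
  fix j assume "j < length (window y i (m + n))"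
  then have j: "j < m + n" by simp
  show "window y i (m + n) ! j = (window y i m @ window y (i + int m) n) ! j"
  proof (cases "j < m")
    case True
    then show ?thesis by (simp add: nth_append)
  next
    case False
    then have "j - m < n" "i + int m + int (j - m) = i + int j" using j by auto
    then show ?thesis using False j by (simp add: nth_append)
  qed
qed simp

lemma window_in_lists: "y \<in> full_shift A \<Longrightarrow> window y i n \<in> lists A"
  by (auto simp: window_def full_shift_def image_subset_iff)

lemma window_morphism_seq_right:
  assumes m: "word_morphism A B \<tau>" and y: "y \<in> full_shift A"
  shows "window (morphism_seq \<tau> y) 0 (length (\<tau> (window y 0 n))) = \<tau> (window y 0 n)"
proof (rule nth_equalityI)
  fix j assume "j < length (window (morphism_seq \<tau> y) 0 (length (\<tau> (window y 0 n))))"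
  then have j: "j < length (\<tau> (window y 0 n))" by simp
  have pre: "\<tau> (window y 0 p) ! j = \<tau> (window y 0 q) ! j"
    if "p \<le> q" "j < length (\<tau> (window y 0 p))" for p q
  proof -
    have "window y 0 q = window y 0 p @ window y (int p) (q - p)"
      using window_add[of y 0 p "q - p"] that by simp
    then have "\<tau> (window y 0 q) = \<tau> (window y 0 p) @ \<tau> (window y (int p) (q - p))"
      using m window_in_lists[OF y] by (simp add: word_morphism_def)
    then show ?thesis using that by (simp add: nth_append)
  qed
  have j': "j < length (\<tau> (window y 0 (j + 1)))"
  proof -
    have "j + 1 \<le> length (\<tau> (window y 0 (j + 1)))"
      using length_morphism_ge[OF m window_in_lists[OF y], of 0 "j + 1"] unfolding length_window .
    then show ?thesis by (rule Suc_le_lessD[OF ord_eq_le_trans[OF Suc_eq_plus1]])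
  qed
  have "\<tau> (window y 0 (j + 1)) ! j = \<tau> (window y 0 n) ! j"
  proof (cases "j + 1 \<le> n")
    case True
    then show ?thesis using j' by (rule pre)
  next
    case False
    then have "n \<le> j + 1" by linarith
    then show ?thesis using j by (rule pre[symmetric])
  qed
  then show "window (morphism_seq \<tau> y) 0 (length (\<tau> (window y 0 n))) ! j = \<tau> (window y 0 n) ! j"
    using j by (simp add: morphism_seq_def)
qed simp

lemma window_morphism_seq_left:
  assumes m: "word_morphism A B \<tau>" and y: "y \<in> full_shift A"
  defines "w \<equiv> (\<lambda>n. \<tau> (window y (- int n) n))"
  shows "window (morphism_seq \<tau> y) (- int (length (w n))) (length (w n)) = w n"
proof -
  have pre: "rev (w p) ! j = rev (w q) ! j" if "p \<le> q" "j < length (w p)" for p q j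
  proof -
    have "window y (- int q) q = window y (- int q) (q - p) @ window y (- int p) p"
      using window_add[of y "- int q" "q - p" p] that by (simp add: of_nat_diff)
    then have "w q = \<tau> (window y (- int q) (q - p)) @ w p"
      using m window_in_lists[OF y] by (simp add: word_morphism_def w_def)
    then show ?thesis using that by (simp add: nth_append)
  qed
  show ?thesis
  proof (rule nth_equalityI)
    fix i assume "i < length (window (morphism_seq \<tau> y) (- int (length (w n))) (length (w n)))"
    then have i: "i < length (w n)" by simp
    define j where "j = length (w n) - 1 - i"
    have j: "j < length (w n)" "w n ! i = rev (w n) ! j"
      using i by (auto simp: j_def rev_nth)
    have "j + 1 \<le> length (w (j + 1))"
      using length_morphism_ge[OF m window_in_lists[OF y], of "- int (j + 1)" "j + 1"]
      unfolding w_def length_window .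
    then have j': "j < length (w (j + 1))" by (rule Suc_le_lessD[OF ord_eq_le_trans[OF Suc_eq_plus1]])
    have e: "rev (w (j + 1)) ! j = rev (w n) ! j"
    proof (cases "j + 1 \<le> n")
      case True
      then show ?thesis using j' by (rule pre)
    next
      case False
      then have "n \<le> j + 1" by linarith
      then show ?thesis using j(1) by (rule pre[symmetric])
    qed
    have "- int (length (w n)) + int i = - int (j + 1)" using i unfolding j_def by linarith
    then have "window (morphism_seq \<tau> y) (- int (length (w n))) (length (w n)) ! i
        = morphism_seq \<tau> y (- int (j + 1))"
      using i by simp
    also have "\<dots> = rev (w (j + 1)) ! j"
    proof -
      have "nat (- (- int (j + 1))) = j + 1" "nat (- (- int (j + 1)) - 1) = j"
        "\<not> 0 \<le> - int (j + 1)" by auto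
      then show ?thesis unfolding morphism_seq_def w_def by (simp only: if_False)
    qed
    finally show "window (morphism_seq \<tau> y) (- int (length (w n))) (length (w n)) ! i = w n ! i"
      using e j by simp
  qed simp
qed

end

theory Submission
  imports Defs
begin

text \<open>
  The proof describes the points of an infinite minimal subshift \<open>Y\<close> by codings. A coding consists of
  finitely many distinct blocks of one length \<open>l\<close> and a marker word \<open>m\<close>, such that in every point of \<open>Y\<close> the
  occurrences of \<open>m\<close> form exactly one residue class modulo \<open>l\<close> and the \<open>l\<close> letters read from an occurrence
  form a block. Every point is then a concatenation of blocks in a unique way. Whether \<open>Y\<close> has a given coding
  can be read off its words of length \<open>|m| + l\<close>, so this is a clopen condition on \<open>Y\<close>.

  Suppose that \<open>Y\<close> has an infinite chain of codings in which each new block is a concatenation of old ones,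
  all new blocks start with the same old block and end with the same old block, each new block contains all
  pairs of consecutive old blocks, and each new marker starts with the old one. Spelling new blocks by old
  ones gives a directive sequence of constant length that is proper and primitive. Its subshift of level \<open>n\<close>
  is the set of sequences of block names of the \<open>n\<close>-th coding (\<open>sadic_eq_decoded\<close>): the pair condition lets
  every short window be seen inside a single block of a later level. It is recognizable since the markers
  reveal where to cut. If all codings except the first have two blocks, the rank is at most two.

  After an arbitrarily small perturbation of \<open>Y\<close>, a given coding of \<open>Y\<close> can be refined by a coding with two
  blocks (\<open>refined_coding_dense\<close>). Take a long word \<open>w\<close> of \<open>Y\<close> that starts with the marker. As \<open>Y\<close> is
  not periodic, \<open>w\<close> has two different return words \<open>u\<close> and \<open>v\<close>. In a concatenation of return words, \<open>w\<close>
  is seen only at the seams, so such a concatenation can be decoded. The blocks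
  \<open>u\<^sup>K v u v v\<close> and \<open>u\<^sup>K v v u v\<close> have equal length, and the word \<open>u\<^sup>K w\<close> marks where they start.
  Writing them along any infinite minimal binary subshift yields an infinite minimal subshift that has the
  same words as \<open>Y\<close> up to a prescribed length.

  Hence, for each coding, the subshifts that lack it or have a refinement of it form an open dense set. There
  are countably many codings and the space is a Baire space, so the intersection of these sets is a dense
  \<open>G\<close>-delta set. A subshift in the intersection has the coding by its letters, and from there it can be
  refined forever.
\<close>

section \<open>Translates, windows and languages\<close>

definition translate :: "int \<Rightarrow> (int \<Rightarrow> int) \<Rightarrow> (int \<Rightarrow> int)" where
  "translate k y = (\<lambda>i. y (i + k))"

lemma translate_0 [simp]: "translate 0 y = y"
  by (simp add: translate_def)

lemma translate_translate [simp]: "translate j (translate k y) = translate (j + k) y"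
  by (simp add: translate_def algebra_simps)

lemma shift_eq_translate: "shift = translate 1"
  by (simp add: fun_eq_iff shift_def translate_def)

lemma funpow_shift: "(shift ^^ k) x = translate (int k) x"
  by (induction k) (simp_all add: shift_eq_translate)

lemma window_translate [simp]: "window (translate k y) i n = window y (i + k) n"
  by (simp add: window_def translate_def algebra_simps)

lemma window_eq_iff: "window x i n = window y j n \<longleftrightarrow> (\<forall>k<n. x (i + int k) = y (j + int k))"
  by (auto simp: list_eq_iff_nth_eq)

lemma take_window: "take k (window y i n) = window y i (min k n)"
  by (auto simp: list_eq_iff_nth_eq)

lemma drop_window: "drop k (window y i n) = window y (i + int k) (n - k)"
  by (auto simp: list_eq_iff_nth_eq algebra_simps)

lemma take_drop_window: "j + n \<le> N \<Longrightarrow> take n (drop j (window y i N)) = window y (i + int j) n"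
  by (simp add: take_window drop_window)

lemma translate_in_subshift:
  assumes X: "X \<in> subshifts" and y: "y \<in> X"
  shows "translate k y \<in> X"
proof (rule in_subshift_if_windows[OF X])
  have pos: "translate (int n) x \<in> X" if "x \<in> X" for n x
    using that
  proof (induction n)
    case (Suc n)
    then have "shift (translate (int n) x) \<in> X" using X unfolding subshifts_def by blast
    then show ?case by (simp add: shift_eq_translate)
  qed simp
  have neg: "\<exists>x\<in>X. y = translate (int n) x" for n
  proof (induction n)
    case (Suc n)
    then obtain x where "x \<in> X" "y = translate (int n) x" by blast
    moreover obtain z where "z \<in> X" "x = shift z" using X \<open>x \<in> X\<close> unfolding subshifts_def by blast
    ultimately show ?case by (auto simp: shift_eq_translate add.commute)
  qed (use y in simp)
  fix i n
  obtain x where x: "x \<in> X" "y = translate (int (nat \<bar>k\<bar>)) x" using neg by blast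
  have "int (nat (k + \<bar>k\<bar>)) = k + \<bar>k\<bar>" by simp
  then have "translate k y = translate (int (nat (k + \<bar>k\<bar>))) x" using x(2) by simp
  then have "translate k y \<in> X" using pos[OF x(1)] by metis
  then show "window (translate k y) i n \<in> language n X" unfolding language_def by blast
qed

lemma shift_image_eq:
  assumes "\<And>y k. y \<in> X \<Longrightarrow> translate k y \<in> X"
  shows "shift ` X = X"
proof (intro equalityI subsetI)
  fix y assume "y \<in> X"
  then have "translate (- 1) y \<in> X" by (rule assms)
  moreover have "y = shift (translate (- 1) y)" by (simp add: shift_eq_translate)
  ultimately show "y \<in> shift ` X" by blast
qed (auto simp: shift_eq_translate assms)

lemma window_in_language: "x \<in> X \<Longrightarrow> window x i n \<in> language n X"
  by (auto simp: language_def)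

lemma languageE:
  assumes "w \<in> language n X"
  obtains x i where "x \<in> X" "w = window x i n"
  using assms by (auto simp: language_def)

lemma language_at:
  assumes "X \<in> subshifts" "w \<in> language n X"
  obtains x where "x \<in> X" "window x i n = w"
proof -
  obtain x j where x: "x \<in> X" "w = window x j n" using assms(2) by (rule languageE)
  show thesis
    by (rule that[of "translate (j - i) x"]) (use x translate_in_subshift[OF assms(1)] in auto)
qed

lemma language_shorter: "n \<le> N \<Longrightarrow> language n X = take n ` language N X"
  unfolding language_def by (force simp: take_window min_def)

lemma language_eq_shorter: "language N X = language N Y \<Longrightarrow> n \<le> N \<Longrightarrow> language n X = language n Y"
  by (simp add: language_shorter)

lemma subword_of_language:
  assumes "w \<in> language N X" "j + n \<le> N"
  shows "take n (drop j w) \<in> language n X"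
proof -
  obtain x i where "x \<in> X" "w = window x i N" using assms(1) by (rule languageE)
  then show ?thesis using take_drop_window[OF assms(2)] window_in_language by simp
qed

lemma subshift_alphabet:
  assumes "X \<in> subshifts"
  obtains A where "finite A" "X \<subseteq> full_shift A"
  using assms by (auto simp: subshifts_def)

lemma finite_language:
  assumes "X \<in> subshifts"
  shows "finite (language n X)"
proof -
  obtain A where A: "finite A" "X \<subseteq> full_shift A" using assms by (rule subshift_alphabet)
  have "language n X \<subseteq> {w. set w \<subseteq> A \<and> length w = n}"
    using window_in_lists A(2) unfolding language_def by fastforce
  then show ?thesis using finite_lists_length_eq[OF A(1)] finite_subset by blast
qed

section \<open>Topology of sequences\<close>

lemma open_cylinder: "open {x :: int \<Rightarrow> int. window x i n = w}"
proof (cases "length w = n")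
  case True
  have "open {x :: int \<Rightarrow> int. x k = a}" for k a
  proof -
    have "open ((\<lambda>x :: int \<Rightarrow> int. x k) -` {a})"
      by (intro open_vimage continuous_on_product_coordinates) (simp add: open_discrete)
    then show ?thesis by (simp add: vimage_def)
  qed
  then have "open (\<Inter>j\<in>{..<n}. {x :: int \<Rightarrow> int. x (i + int j) = w ! j})" by (intro open_INT) auto
  moreover have "{x. window x i n = w} = (\<Inter>j\<in>{..<n}. {x. x (i + int j) = w ! j})"
    using True by (auto simp: list_eq_iff_nth_eq)
  ultimately show ?thesis by simp
next
  case False
  then have "{x. window x i n = w} = {}" by auto
  then show ?thesis by simp
qed

lemma closed_cylinder: "closed {x :: int \<Rightarrow> int. window x i n \<in> W}"
proof -
  have "- {x. window x i n \<in> W} = (\<Union>w\<in>-W. {x. window x i n = w})" by auto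
  then show ?thesis unfolding closed_def using open_cylinder by (metis open_UN)
qed

lemma compact_full_shift: "finite A \<Longrightarrow> compact (full_shift A)"
proof -
  assume "finite A"
  then have "compactin (product_topology (\<lambda>i::int. euclidean) UNIV) (PiE UNIV (\<lambda>_. A))"
    by (subst compactin_PiE) (auto simp: finite_imp_compact)
  moreover have "PiE UNIV (\<lambda>_. A) = full_shift A" by (auto simp: full_shift_def)
  ultimately show ?thesis by (simp add: euclidean_product_topology)
qed

lemma compact_subshift:
  assumes "X \<in> subshifts"
  shows "compact X"
proof -
  obtain A where A: "finite A" "X \<subseteq> full_shift A" using assms by (rule subshift_alphabet)
  have "compact (full_shift A \<inter> X)"
    using assms compact_full_shift[OF A(1)] by (intro compact_Int_closed) (auto simp: subshifts_def)
  then show ?thesis using A(2) by (simp add: inf.absorb2)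
qed

lemma in_closure_iff_windows:
  "y \<in> closure S \<longleftrightarrow> (\<forall>n. \<exists>x\<in>S. window x (- int n) (2 * n + 1) = window y (- int n) (2 * n + 1))"
proof
  assume y: "y \<in> closure S"
  show "\<forall>n. \<exists>x\<in>S. window x (- int n) (2 * n + 1) = window y (- int n) (2 * n + 1)"
  proof
    fix n
    let ?U = "{x. window x (- int n) (2 * n + 1) = window y (- int n) (2 * n + 1)}"
    have "?U \<inter> closure S \<noteq> {}" using y by blast
    then have "?U \<inter> S \<noteq> {}" using open_Int_closure_eq_empty[OF open_cylinder] by blast
    then show "\<exists>x\<in>S. window x (- int n) (2 * n + 1) = window y (- int n) (2 * n + 1)" by blast
  qed
next
  assume "\<forall>n. \<exists>x\<in>S. window x (- int n) (2 * n + 1) = window y (- int n) (2 * n + 1)"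
  then obtain f where f: "\<And>n. f n \<in> S"
    "\<And>n. window (f n) (- int n) (2 * n + 1) = window y (- int n) (2 * n + 1)" by metis
  have "((\<lambda>n. f n i) \<longlongrightarrow> y i) sequentially" for i
  proof (rule tendsto_eventually, rule eventually_sequentiallyI)
    fix n assume "nat \<bar>i\<bar> \<le> n"
    then have "nat (i + int n) < 2 * n + 1" "- int n + int (nat (i + int n)) = i" by linarith+
    then show "f n i = y i" using f(2)[of n] unfolding window_eq_iff by metis
  qed
  then have "f \<longlonglongrightarrow> y"
    using limitin_componentwise[of "\<lambda>_. euclidean" UNIV f y sequentially]
    by (simp add: euclidean_product_topology)
  then show "y \<in> closure S"
    using closed_sequentially[OF closed_closure] f(1) closure_subset by blast
qed

text \<open>A point in the closure shares each central window with some point of the set; by compactness,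
  a single point of the set shares all of them.\<close>

lemma closed_if_compact:
  fixes S :: "(int \<Rightarrow> int) set"
  assumes "compact S"
  shows "closed S"
proof -
  have "y \<in> S" if y: "y \<in> closure S" for y
  proof -
    define C where "C n = {x. window x (- int n) (2 * n + 1) \<in> {window y (- int n) (2 * n + 1)}}" for n
    have mono: "C N \<subseteq> C n" if "n \<le> N" for n N
    proof
      fix x assume "x \<in> C N"
      then have "window x (- int N) (2 * N + 1) = window y (- int N) (2 * N + 1)" by (simp add: C_def)
      then have "take (2 * n + 1) (drop (N - n) (window x (- int N) (2 * N + 1))) =
          take (2 * n + 1) (drop (N - n) (window y (- int N) (2 * N + 1)))" by simp
      then show "x \<in> C n" using \<open>n \<le> N\<close> by (simp add: take_drop_window C_def of_nat_diff)
    qed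
    have "S \<inter> (\<Inter>n\<in>UNIV. C n) \<noteq> {}"
    proof (rule compact_imp_fip_image[OF assms])
      show "closed (C n)" for n unfolding C_def by (rule closed_cylinder)
      fix I :: "nat set" assume I: "finite I"
      obtain x where "x \<in> S" "x \<in> C (Max (insert 0 I))"
        using y unfolding in_closure_iff_windows C_def by blast
      moreover have "C (Max (insert 0 I)) \<subseteq> C n" if "n \<in> I" for n
        using I that by (intro mono Max_ge) auto
      ultimately show "S \<inter> (\<Inter>n\<in>I. C n) \<noteq> {}" by blast
    qed
    then obtain x where x: "x \<in> S" "\<And>n. x \<in> C n" by blast
    have "x i = y i" for i
    proof -
      have "window x (- int (nat \<bar>i\<bar>)) (2 * nat \<bar>i\<bar> + 1) = window y (- int (nat \<bar>i\<bar>)) (2 * nat \<bar>i\<bar> + 1)"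
        using x(2)[of "nat \<bar>i\<bar>"] by (simp add: C_def)
      moreover have "nat (i + \<bar>i\<bar>) < 2 * nat \<bar>i\<bar> + 1" "- int (nat \<bar>i\<bar>) + int (nat (i + \<bar>i\<bar>)) = i" by linarith+
      ultimately show ?thesis unfolding window_eq_iff by metis
    qed
    then have "x = y" by (rule ext)
    then show ?thesis using x(1) by simp
  qed
  then show ?thesis using closure_subset_eq by blast
qed

lemma continuous_local_map:
  fixes h :: "int \<Rightarrow> int \<Rightarrow> int" and c :: "int \<Rightarrow> int"
  shows "continuous_on X (\<lambda>z i. h i (z (c i)))"
proof (rule continuous_on_coordinatewise_then_product)
  fix i
  have "continuous_on UNIV (h i)" by simp
  then show "continuous_on X (\<lambda>z. h i (z (c i)))"
    by (rule continuous_on_compose2) (auto intro: continuous_on_product_coordinates continuous_on_subset)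
qed

text \<open>A closure is tested by central windows, and a central window of a translate of \<open>x\<close> is an
  arbitrary window of \<open>x\<close>.\<close>

lemma minimal_subshift_iff:
  assumes X: "X \<in> subshifts"
  shows "minimal_subshift X \<longleftrightarrow> (\<forall>x\<in>X. \<forall>n. \<forall>w\<in>language n X. \<exists>t. window x t n = w)"
proof
  assume "minimal_subshift X"
  then have cl: "X \<subseteq> closure (shift_orbit x)" if "x \<in> X" for x
    using that by (simp add: minimal_subshift_def)
  show "\<forall>x\<in>X. \<forall>n. \<forall>w\<in>language n X. \<exists>t. window x t n = w"
  proof (intro ballI allI)
    fix x n w assume x: "x \<in> X" and w: "w \<in> language n X"
    obtain y where y: "y \<in> X" "window y 0 n = w" using language_at[OF X w] by blast
    then obtain z where z: "z \<in> shift_orbit x"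
      "window z (- int n) (2 * n + 1) = window y (- int n) (2 * n + 1)"
      using cl[OF x] in_closure_iff_windows by blast
    then have "window z 0 n = window y 0 n"
      using take_drop_window[of n n "2 * n + 1" z "- int n"]
        take_drop_window[of n n "2 * n + 1" y "- int n"] by simp
    moreover obtain k where "z = translate k x" using z(1) unfolding shift_orbit_def translate_def by blast
    ultimately have "window x k n = w" using y(2) by simp
    then show "\<exists>t. window x t n = w" ..
  qed
next
  assume *: "\<forall>x\<in>X. \<forall>n. \<forall>w\<in>language n X. \<exists>t. window x t n = w"
  have "y \<in> closure (shift_orbit x)" if x: "x \<in> X" and y: "y \<in> X" for x y
    unfolding in_closure_iff_windows
  proof
    fix n
    obtain t where t: "window x t (2 * n + 1) = window y (- int n) (2 * n + 1)"
      using *[rule_format, OF x window_in_language[OF y]] by blast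
    have "translate (t + int n) x \<in> shift_orbit x" unfolding shift_orbit_def translate_def by blast
    then show "\<exists>x\<in>shift_orbit x. window x (- int n) (2 * n + 1) = window y (- int n) (2 * n + 1)"
      using t by (intro bexI) auto
  qed
  then show "minimal_subshift X" using X by (auto simp: minimal_subshift_def)
qed

lemma minimal_occurs:
  assumes "minimal_subshift X" "x \<in> X" "w \<in> language n X"
  obtains t where "window x t n = w"
  using assms minimal_subshift_iff[of X] unfolding minimal_subshift_def by metis

text \<open>The points with an occurrence at a given position form an open set, and by compactness
  finitely many positions suffice for all points.\<close>

lemma minimal_bounded_gaps:
  assumes "minimal_subshift X" "w \<in> language n X"
  obtains R where "\<And>x s. x \<in> X \<Longrightarrow> \<exists>t. s \<le> t \<and> t \<le> s + int R \<and> window x t n = w"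
proof -
  have X: "X \<in> subshifts" using assms(1) by (simp add: minimal_subshift_def)
  let ?C = "\<lambda>t. {x. window x t n = w}"
  have op: "open (?C t)" for t by (rule open_cylinder)
  have cover: "X \<subseteq> (\<Union>t\<in>UNIV. ?C t)" using minimal_occurs[OF assms(1) _ assms(2)] by blast
  obtain T where T: "T \<subseteq> UNIV" "finite T" "X \<subseteq> (\<Union>t\<in>T. ?C t)"
    by (rule compactE_image[OF compact_subshift[OF X] op cover])
  obtain M :: nat where M: "\<And>t. t \<in> T \<Longrightarrow> \<bar>t\<bar> \<le> int M"
  proof
    fix t assume "t \<in> T"
    then have "nat \<bar>t\<bar> \<le> (\<Sum>t\<in>T. nat \<bar>t\<bar>)" using T(2) by (intro member_le_sum) auto
    then show "\<bar>t\<bar> \<le> int (\<Sum>t\<in>T. nat \<bar>t\<bar>)" by linarith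
  qed
  show thesis
  proof (rule that[of "2 * M"])
    fix x s assume "x \<in> X"
    then have "translate (s + int M) x \<in> X" by (rule translate_in_subshift[OF X])
    then obtain t where "t \<in> T" "window x (t + (s + int M)) n = w" using T(3) by auto
    then show "\<exists>t\<ge>s. t \<le> s + int (2 * M) \<and> window x t n = w"
      using M[of t] by (intro exI[of _ "t + (s + int M)"]) auto
  qed
qed

text \<open>Finitely many points have at most that many windows at the origin, while one large window
  separates any given finite set of points.\<close>

lemma infinite_iff_language_unbounded:
  assumes X: "X \<in> subshifts"
  shows "infinite X \<longleftrightarrow> (\<forall>k. \<exists>n. k < card (language n X))"
proof
  assume inf: "infinite X"
  show "\<forall>k. \<exists>n. k < card (language n X)"
  proof
    fix k
    obtain F where F: "F \<subseteq> X" "finite F" "card F = Suc k"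
      using infinite_arbitrarily_large[OF inf] by blast
    have "\<forall>p. \<exists>i. fst p \<noteq> snd p \<longrightarrow> fst p i \<noteq> (snd p i :: int)"
      by (auto simp: fun_eq_iff)
    from choice[OF this] obtain d :: "(int \<Rightarrow> int) \<times> (int \<Rightarrow> int) \<Rightarrow> int"
      where "\<forall>p. fst p \<noteq> snd p \<longrightarrow> fst p (d p) \<noteq> snd p (d p)" ..
    then have d: "x (d (x, y)) \<noteq> y (d (x, y))" if "x \<noteq> y" for x y
      using that by (auto dest: spec[of _ "(x, y)"])
    define n where "n = (\<Sum>p\<in>F \<times> F. nat \<bar>d p\<bar>)"
    have "inj_on (\<lambda>x. window x (- int n) (2 * n + 1)) F"
    proof (rule inj_onI, rule ccontr)
      fix x y assume xy: "x \<in> F" "y \<in> F" "x \<noteq> y"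
        and w: "window x (- int n) (2 * n + 1) = window y (- int n) (2 * n + 1)"
      let ?i = "d (x, y)"
      have "nat \<bar>?i\<bar> \<le> n"
        unfolding n_def using xy F(2) by (intro member_le_sum) auto
      then have "nat (?i + int n) < 2 * n + 1" "- int n + int (nat (?i + int n)) = ?i" by linarith+
      then have "x ?i = y ?i" using w[unfolded window_eq_iff, rule_format, of "nat (?i + int n)"] by simp
      then show False using d[OF xy(3)] by contradiction
    qed
    then have "Suc k = card ((\<lambda>x. window x (- int n) (2 * n + 1)) ` F)" using F(3) by (simp add: card_image)
    also have "\<dots> \<le> card (language (2 * n + 1) X)"
      using F(1) window_in_language by (intro card_mono finite_language X) blast
    finally show "\<exists>n. k < card (language n X)" by (intro exI) (rule Suc_le_lessD)
  qed
next
  assume *: "\<forall>k. \<exists>n. k < card (language n X)"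
  show "infinite X"
  proof
    assume fin: "finite X"
    obtain n where n: "card X < card (language n X)" using * by blast
    have "language n X \<subseteq> (\<lambda>x. window x 0 n) ` X"
    proof
      fix w assume "w \<in> language n X"
      then obtain x where "x \<in> X" "window x 0 n = w" by (rule language_at[OF X])
      then show "w \<in> (\<lambda>x. window x 0 n) ` X" by blast
    qed
    then have "card (language n X) \<le> card X" using fin surj_card_le by blast
    then show False using n by simp
  qed
qed

lemma finite_minimal_if_periodic:
  assumes min: "minimal_subshift X" and x: "x \<in> X" and p: "p > 0" "\<And>i. x (i + int p) = x i"
  shows "finite X"
proof (rule ccontr)
  assume inf: "infinite X"
  have m: "x (i + k * int p) = x i" for i k
  proof (induction k rule: int_induct[where k = 0])
    case (step1 k) then show ?case using p(2)[of "i + k * int p"] by (simp add: algebra_simps)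
  next
    case (step2 k) then show ?case using p(2)[of "i + (k - 1) * int p"] by (simp add: algebra_simps)
  qed simp
  have "language n X \<subseteq> (\<lambda>t. window x (int t) n) ` {..<p}" for n
  proof
    fix w assume "w \<in> language n X"
    then obtain t where t: "window x t n = w" using minimal_occurs[OF min x] by blast
    have "window x t n = window x (int (nat (t mod int p))) n"
      unfolding window_eq_iff
    proof (intro allI impI)
      fix k
      have "t + int k = t mod int p + int k + (t div int p) * int p" by simp
      then show "x (t + int k) = x (int (nat (t mod int p)) + int k)"
        using m[of "t mod int p + int k" "t div int p"] p(1) by simp
    qed
    moreover have "nat (t mod int p) < p" using p(1) by (simp add: nat_less_iff)
    ultimately show "w \<in> (\<lambda>t. window x (int t) n) ` {..<p}" using t by blast
  qed
  then have le: "card (language n X) \<le> p" for n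
    using surj_card_le[of "{..<p}" "language n X" "\<lambda>t. window x (int t) n"] by simp
  have "X \<in> subshifts" using min by (simp add: minimal_subshift_def)
  then obtain n where "p < card (language n X)"
    using inf infinite_iff_language_unbounded by blast
  then show False using le[of n] by simp
qed

section \<open>The space of infinite minimal subshifts is a Baire space\<close>

lemma subshift_dist_less_iff:
  "subshift_dist X Y < (1 / 2) ^ n \<longleftrightarrow> (\<forall>k\<le>n. language k X = language k Y)"
proof (cases "\<forall>n. language n X = language n Y")
  case False
  define m where "m = Inf {n. language n X \<noteq> language n Y}"
  have m: "language m X \<noteq> language m Y"
    unfolding m_def using Inf_nat_def1[of "{n. language n X \<noteq> language n Y}"] False by auto
  have m': "language k X = language k Y" if "k < m" for k
  proof (rule ccontr)
    assume "language k X \<noteq> language k Y"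
    then have "m \<le> k" unfolding m_def by (intro cInf_lower) auto
    then show False using that by simp
  qed
  have "subshift_dist X Y = (1/2) ^ m" using False by (simp add: subshift_dist_def m_def)
  then have "subshift_dist X Y < (1 / 2) ^ n \<longleftrightarrow> n < m" by simp
  also have "\<dots> \<longleftrightarrow> (\<forall>k\<le>n. language k X = language k Y)" using m m' by (metis leI le_less_trans)
  finally show ?thesis .
qed (simp add: subshift_dist_def)

text \<open>The words of length \<open>n\<close> determine the shorter ones, so a single language describes a ball.\<close>

lemma subshift_dist_less_iff_same_language:
  "subshift_dist X Y < (1 / 2) ^ n \<longleftrightarrow> language n X = language n Y"
  unfolding subshift_dist_less_iff using language_eq_shorter by blast

lemma openin_subshift_space:
  "openin subshift_space U \<longleftrightarrow> U \<subseteq> subshifts \<and> (\<forall>X\<in>U. \<exists>n. \<forall>Y\<in>subshifts. language n Y = language n X \<longrightarrow> Y \<in> U)"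
proof -
  interpret Metric_space subshifts subshift_dist by (rule Metric_space_subshifts)
  have "(\<exists>r>0. mball X r \<subseteq> U) \<longleftrightarrow> (\<exists>n. \<forall>Y\<in>subshifts. language n Y = language n X \<longrightarrow> Y \<in> U)"
    if "X \<in> subshifts" for X
  proof
    assume "\<exists>r>0. mball X r \<subseteq> U"
    then obtain r where r: "r > 0" "mball X r \<subseteq> U" by blast
    obtain n where n: "(1 / 2) ^ n < r" using real_arch_pow_inv[OF r(1), of "1/2"] by auto
    have "Y \<in> U" if Y: "Y \<in> subshifts" "language n Y = language n X" for Y
    proof -
      have "subshift_dist X Y < (1 / 2) ^ n" using Y(2) by (simp add: subshift_dist_less_iff_same_language)
      then show ?thesis using r(2) n Y(1) \<open>X \<in> subshifts\<close> by (auto simp: subset_iff)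
    qed
    then show "\<exists>n. \<forall>Y\<in>subshifts. language n Y = language n X \<longrightarrow> Y \<in> U" by blast
  next
    assume "\<exists>n. \<forall>Y\<in>subshifts. language n Y = language n X \<longrightarrow> Y \<in> U"
    then obtain n where "\<forall>Y\<in>subshifts. language n Y = language n X \<longrightarrow> Y \<in> U" ..
    then have "mball X ((1 / 2) ^ n) \<subseteq> U" by (auto simp: subshift_dist_less_iff_same_language)
    then show "\<exists>r>0. mball X r \<subseteq> U" by (intro exI[of _ "(1/2)^n"]) simp
  qed
  then show ?thesis unfolding subshift_space_def openin_mtopology by blast
qed

lemma openin_infinite_minimal_space:
  "openin infinite_minimal_space U \<longleftrightarrow> U \<subseteq> infinite_minimal_subshifts \<and>
     (\<forall>X\<in>U. \<exists>n. \<forall>Y\<in>infinite_minimal_subshifts. language n Y = language n X \<longrightarrow> Y \<in> U)"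
proof
  assume "openin infinite_minimal_space U"
  then obtain T where T: "openin subshift_space T" "U = T \<inter> infinite_minimal_subshifts"
    unfolding infinite_minimal_space_def openin_subtopology by blast
  have "\<exists>n. \<forall>Y\<in>infinite_minimal_subshifts. language n Y = language n X \<longrightarrow> Y \<in> U" if X: "X \<in> U" for X
  proof -
    have "X \<in> T" using T(2) X by blast
    then obtain n where n: "\<forall>Y\<in>subshifts. language n Y = language n X \<longrightarrow> Y \<in> T"
      using T(1) unfolding openin_subshift_space by blast
    have "infinite_minimal_subshifts \<subseteq> subshifts"
      by (auto simp: infinite_minimal_subshifts_def minimal_subshift_def)
    then show ?thesis using n T(2) by blast
  qed
  then show "U \<subseteq> infinite_minimal_subshifts \<and>
     (\<forall>X\<in>U. \<exists>n. \<forall>Y\<in>infinite_minimal_subshifts. language n Y = language n X \<longrightarrow> Y \<in> U)"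
    using T(2) by blast
next
  assume *: "U \<subseteq> infinite_minimal_subshifts \<and>
     (\<forall>X\<in>U. \<exists>n. \<forall>Y\<in>infinite_minimal_subshifts. language n Y = language n X \<longrightarrow> Y \<in> U)"
  then obtain n where n:
    "\<And>X Y. X \<in> U \<Longrightarrow> Y \<in> infinite_minimal_subshifts \<Longrightarrow> language (n X) Y = language (n X) X \<Longrightarrow> Y \<in> U"
    by metis
  define T where "T = {Y \<in> subshifts. \<exists>X\<in>U. language (n X) Y = language (n X) X}"
  have "openin subshift_space T"
    unfolding openin_subshift_space T_def by auto
  moreover have "U = T \<inter> infinite_minimal_subshifts"
  proof -
    have "infinite_minimal_subshifts \<subseteq> subshifts"
      by (auto simp: infinite_minimal_subshifts_def minimal_subshift_def)
    then show ?thesis using * n unfolding T_def by blast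
  qed
  ultimately show "openin infinite_minimal_space U"
    unfolding infinite_minimal_space_def openin_subtopology by blast
qed

text \<open>The conditions on \<open>x\<close> are closed and hold for \<open>f N\<close> up to length \<open>N\<close>; by compactness they hold
  simultaneously for one point.\<close>

lemma compatible_limit:
  assumes A: "finite A"
    and f: "\<And>N. f N \<in> full_shift A"
    and L: "\<And>N i n. n \<le> N \<Longrightarrow> window (f N) i n \<in> L n"
    and w: "\<And>N. window (f N) 0 k = w"
  obtains x where "x \<in> full_shift A" "\<And>i n. window x i n \<in> L n" "window x 0 k = w"
proof -
  define C where "C N = {x. window x 0 k = w} \<inter> (\<Inter>i. \<Inter>n\<in>{..N}. {x. window x i n \<in> L n})" for N
  have "full_shift A \<inter> (\<Inter>N\<in>UNIV. C N) \<noteq> {}"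
  proof (rule compact_imp_fip_image[OF compact_full_shift[OF A]])
    show "closed (C N)" for N
      using closed_cylinder[of 0 k "{w}"] unfolding C_def by (intro closed_Int closed_INT ballI closed_cylinder) simp
    fix I :: "nat set" assume "finite I"
    then have "f (Max (insert 0 I)) \<in> C N" if "N \<in> I" for N
      using that L w by (auto simp: C_def) (meson Max_ge finite_insert insertI2 le_trans)
    then show "full_shift A \<inter> (\<Inter>N\<in>I. C N) \<noteq> {}" using f by blast
  qed
  then obtain x where x: "x \<in> full_shift A" "\<And>N. x \<in> C N" by blast
  have "window x i n \<in> L n" for i n using x(2)[of n] by (auto simp: C_def)
  moreover have "window x 0 k = w" using x(2)[of 0] by (simp add: C_def)
  ultimately show thesis using that x(1) by blast
qed

text \<open>Along a Cauchy sequence the language of each length is eventually constant. The limit consists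
  of the sequences all of whose windows lie in these eventual languages; compactness shows that
  it realizes every word in them.\<close>

lemma subshifts_mcomplete: "Metric_space.mcomplete subshifts subshift_dist"
proof -
  interpret Metric_space subshifts subshift_dist by (rule Metric_space_subshifts)
  show mcomplete
    unfolding mcomplete_def
  proof (intro allI impI)
    fix X assume C: "MCauchy X"
    then have Xs: "\<And>k. X k \<in> subshifts" by (auto simp: MCauchy_def)
    have "\<exists>N. \<forall>k\<ge>N. \<forall>l\<ge>N. language n (X k) = language n (X l)" for n
      using C unfolding MCauchy_def subshift_dist_less_iff_same_language[symmetric] by (metis half_gt_zero_iff zero_less_one zero_less_power)
    then obtain N where N: "\<And>n k l. N n \<le> k \<Longrightarrow> N n \<le> l \<Longrightarrow> language n (X k) = language n (X l)"
      by metis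
    define L where "L n = language n (X (N n))" for n
    have L: "language n (X k) = L n" if "N n \<le> k" for n k
      unfolding L_def using N[OF that order_refl] .
    define Y where "Y = {x. \<forall>i n. window x i n \<in> L n}"
    obtain A where A: "finite A" "X (N 1) \<subseteq> full_shift A" using Xs by (rule subshift_alphabet)
    have in_A: "x \<in> full_shift A" if x: "\<And>i. window x i 1 \<in> L 1" for x
    proof -
      have "x i \<in> A" for i
      proof -
        obtain y j where y: "y \<in> X (N 1)" "window x i 1 = window y j 1"
          using x[of i] unfolding L_def by (rule languageE)
        then have "x i = y j" by (simp add: window_eq_iff)
        then show ?thesis using y(1) A(2) by (auto simp: full_shift_def)
      qed
      then show ?thesis by (auto simp: full_shift_def)
    qed
    have Y: "Y \<in> subshifts"
    proof -
      have "Y = (\<Inter>i. \<Inter>n. {x. window x i n \<in> L n})" by (auto simp: Y_def)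
      then have "closed Y" by (simp only:) (intro closed_INT ballI closed_cylinder)
      moreover have "translate k y \<in> Y" if "y \<in> Y" for y k using that by (simp add: Y_def)
      then have "shift ` Y = Y" by (rule shift_image_eq)
      moreover have "Y \<subseteq> full_shift A" using in_A by (auto simp: Y_def)
      ultimately show ?thesis using A(1) by (auto simp: subshifts_def)
    qed
    have lang: "language n Y = L n" for n
    proof
      show "language n Y \<subseteq> L n" by (auto simp: Y_def language_def)
      show "L n \<subseteq> language n Y"
      proof
        fix w assume w: "w \<in> L n"
        have "\<exists>x. x \<in> full_shift A \<and> (\<forall>j\<le>M. \<forall>i. window x i j \<in> L j) \<and> window x 0 n = w" for M
        proof -
          define k where "k = Max (N ` {..M + n + 1})"
          have k: "N j \<le> k" if "j \<le> M + n + 1" for j unfolding k_def using that by (intro Max_ge) auto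
          have "w \<in> language n (X k)" using L[OF k, of n] w by simp
          then obtain x where x: "x \<in> X k" "window x 0 n = w" using language_at[OF Xs] by blast
          have "window x i j \<in> L j" if "j \<le> M + n + 1" for i j
            using L[OF k[OF that]] window_in_language[OF x(1)] by blast
          then show ?thesis using x(2) in_A by (intro exI[of _ x]) auto
        qed
        then obtain f where f: "\<And>M. f M \<in> full_shift A" "\<And>M i j. j \<le> M \<Longrightarrow> window (f M) i j \<in> L j"
          "\<And>M. window (f M) 0 n = w" by metis
        obtain x where "\<And>i j. window x i j \<in> L j" "window x 0 n = w"
          by (rule compatible_limit[OF A(1) f]) auto
        then show "w \<in> language n Y" unfolding language_def Y_def by blast
      qed
    qed
    have "limitin mtopology X Y sequentially"
      unfolding limit_metric_sequentially
    proof (intro conjI Y allI impI)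
      fix e :: real assume "e > 0"
      then obtain n where n: "(1 / 2) ^ n < e" using real_arch_pow_inv[of e "1/2"] by auto
      have "subshift_dist (X k) Y < e" if "N n \<le> k" for k
      proof -
        have "subshift_dist (X k) Y < (1 / 2) ^ n" using L[OF that] lang by (simp add: subshift_dist_less_iff_same_language)
        then show ?thesis using n by simp
      qed
      then show "\<exists>M. \<forall>k\<ge>M. X k \<in> subshifts \<and> subshift_dist (X k) Y < e" using Xs by blast
    qed
    then show "\<exists>Y. limitin mtopology X Y sequentially" ..
  qed
qed

text \<open>The finitely many words of length \<open>n\<close> have a common bound for their gaps. In this form minimality is
  a countable conjunction of conditions, each of which is witnessed by words of bounded length.\<close>

lemma minimal_iff_uniformly_recurrent:
  assumes X: "X \<in> subshifts"
  shows "minimal_subshift X \<longleftrightarrow> (\<forall>n. \<exists>m. \<forall>u\<in>language m X. language n X \<subseteq> {v. sublist v u})"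
proof
  assume min: "minimal_subshift X"
  show "\<forall>n. \<exists>m. \<forall>u\<in>language m X. language n X \<subseteq> {v. sublist v u}"
  proof
    fix n
    have "\<exists>R. \<forall>x\<in>X. \<forall>s. \<exists>t\<ge>s. t \<le> s + int R \<and> window x t n = v" if "v \<in> language n X" for v
      using minimal_bounded_gaps[OF min that] by metis
    then obtain R where R: "\<And>v x s. v \<in> language n X \<Longrightarrow> x \<in> X \<Longrightarrow>
        \<exists>t\<ge>s. t \<le> s + int (R v) \<and> window x t n = v" by metis
    define m where "m = (\<Sum>v\<in>language n X. R v) + n"
    have "sublist v u" if u: "u \<in> language m X" and v: "v \<in> language n X" for u v
    proof -
      obtain x i where x: "x \<in> X" "u = window x i m" using u by (rule languageE)
      obtain t where t: "i \<le> t" "t \<le> i + int (R v)" "window x t n = v" using R[OF v x(1)] by blast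
      have "R v \<le> (\<Sum>v\<in>language n X. R v)" using v finite_language[OF X] by (intro member_le_sum) auto
      then have "v = take n (drop (nat (t - i)) u)"
        using t x(2) by (subst x(2), subst take_drop_window) (auto simp: m_def)
      then show ?thesis by (metis append_take_drop_id sublist_appendI)
    qed
    then show "\<exists>m. \<forall>u\<in>language m X. language n X \<subseteq> {v. sublist v u}" by blast
  qed
next
  assume *: "\<forall>n. \<exists>m. \<forall>u\<in>language m X. language n X \<subseteq> {v. sublist v u}"
  show "minimal_subshift X"
    unfolding minimal_subshift_iff[OF X]
  proof (intro ballI allI)
    fix x n w assume x: "x \<in> X" and w: "w \<in> language n X"
    obtain m where "\<forall>u\<in>language m X. language n X \<subseteq> {v. sublist v u}" using * by blast
    then have "sublist w (window x 0 m)" using w window_in_language[OF x] by blast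
    then obtain p s where ps: "window x 0 m = p @ w @ s" by (auto simp: sublist_def)
    have n: "length w = n" using w by (auto simp: language_def)
    have "length p + n \<le> m" using arg_cong[OF ps, of length] n by simp
    then have "window x (int (length p)) n = take n (drop (length p) (window x 0 m))"
      by (simp add: take_drop_window)
    also have "\<dots> = w" using ps n by simp
    finally show "\<exists>t. window x t n = w" ..
  qed
qed

text \<open>To have more than \<open>k\<close> words of some length, and to be uniformly recurrent for words of length \<open>n\<close>, are
  witnessed by words of bounded length and hence open conditions; a subshift is infinite and minimal if it satisfies
  them for all \<open>k\<close> and \<open>n\<close>.\<close>

lemma gdelta_infinite_minimal_subshifts: "gdelta_in subshift_space infinite_minimal_subshifts"
proof -
  let ?I = "\<lambda>k. {X \<in> subshifts. \<exists>n. k < card (language n X)}"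
  let ?R = "\<lambda>n. {X \<in> subshifts. \<exists>m. \<forall>u\<in>language m X. language n X \<subseteq> {v. sublist v u}}"
  have "openin subshift_space (?I k)" for k
    unfolding openin_subshift_space
  proof (intro conjI ballI)
    fix X assume "X \<in> ?I k"
    then obtain n where "k < card (language n X)" by blast
    then show "\<exists>n. \<forall>Y\<in>subshifts. language n Y = language n X \<longrightarrow> Y \<in> ?I k"
      by (intro exI[of _ n] ballI impI CollectI conjI) auto
  qed auto
  moreover have "openin subshift_space (?R n)" for n
    unfolding openin_subshift_space
  proof (intro conjI ballI)
    fix X assume "X \<in> ?R n"
    then obtain m where m: "\<forall>u\<in>language m X. language n X \<subseteq> {v. sublist v u}" by blast
    show "\<exists>k. \<forall>Y\<in>subshifts. language k Y = language k X \<longrightarrow> Y \<in> ?R n"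
    proof (intro exI[of _ "m + n"] ballI impI)
      fix Y assume Y: "Y \<in> subshifts" "language (m + n) Y = language (m + n) X"
      have "language m Y = language m X" "language n Y = language n X"
        using Y(2) language_eq_shorter le_add1 le_add2 by blast+
      then show "Y \<in> ?R n" using m Y(1) by (intro CollectI conjI exI[of _ m]) simp_all
    qed
  qed auto
  ultimately have op: "openin subshift_space U" if "U \<in> range ?I \<union> range ?R" for U
    using that by auto
  have eq: "infinite_minimal_subshifts = \<Inter> (range ?I \<union> range ?R)"
  proof (intro equalityI subsetI)
    fix X assume "X \<in> infinite_minimal_subshifts"
    then have X: "minimal_subshift X" "infinite X" "X \<in> subshifts"
      by (auto simp: infinite_minimal_subshifts_def minimal_subshift_def)
    then show "X \<in> \<Inter> (range ?I \<union> range ?R)"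
      using minimal_iff_uniformly_recurrent[OF X(3)] infinite_iff_language_unbounded[OF X(3)] by (simp add: ball_Un)
  next
    fix X assume X: "X \<in> \<Inter> (range ?I \<union> range ?R)"
    have "X \<in> ?I k" for k by (rule InterD[OF X UnI1[OF rangeI]])
    moreover have "X \<in> ?R n" for n by (rule InterD[OF X UnI2[OF rangeI]])
    ultimately
    have X: "X \<in> subshifts" "\<exists>n. k < card (language n X)"
      "\<exists>m. \<forall>u\<in>language m X. language n X \<subseteq> {v. sublist v u}" for k n by simp_all
    then show "X \<in> infinite_minimal_subshifts"
      using minimal_iff_uniformly_recurrent[OF X(1)] infinite_iff_language_unbounded[OF X(1)]
      by (simp add: infinite_minimal_subshifts_def)
  qed
  have "(countable intersection_of openin subshift_space) infinite_minimal_subshifts"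
    unfolding intersection_of_def
  proof (intro exI conjI)
    show "countable (range ?I \<union> range ?R)" by simp
    show "range ?I \<union> range ?R \<subseteq> Collect (openin subshift_space)" using op by (intro subsetI CollectI)
  qed (rule eq[symmetric])
  moreover have "infinite_minimal_subshifts \<subseteq> topspace subshift_space"
    unfolding eq by (rule order_trans[OF Inter_lower openin_subset[OF op]]) (rule UnI1, rule rangeI)+
  ultimately show ?thesis by (simp add: gdelta_in_alt)
qed

lemma infinite_minimal_space_Baire:
  assumes "countable G"
    and "\<And>T. T \<in> G \<Longrightarrow> openin infinite_minimal_space T \<and>
            infinite_minimal_space closure_of T = topspace infinite_minimal_space"
  shows "infinite_minimal_space closure_of (\<Inter>G) = topspace infinite_minimal_space"
proof -
  have "completely_metrizable_space subshift_space"
    unfolding subshift_space_def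
    by (rule Metric_space.completely_metrizable_space_mtopology[OF Metric_space_subshifts subshifts_mcomplete])
  then have "completely_metrizable_space infinite_minimal_space"
    unfolding infinite_minimal_space_def
    by (rule completely_metrizable_space_gdelta_in[OF _ gdelta_infinite_minimal_subshifts])
  then show ?thesis using assms by (intro Baire_category) auto
qed

section \<open>Concatenations of blocks of equal length\<close>

abbreviation subst :: "('a \<Rightarrow> 'b list) \<Rightarrow> 'a list \<Rightarrow> 'b list" where
  "subst f w \<equiv> concat (map f w)"

text \<open>The concatenation of the blocks \<open>f (z i)\<close> with \<open>f (z 0)\<close> starting at the origin, provided that all blocks
  have length \<open>l\<close>. Computing positions by division treats both sides of the origin alike.\<close>

definition block_seq :: "nat \<Rightarrow> (int \<Rightarrow> int list) \<Rightarrow> (int \<Rightarrow> int) \<Rightarrow> (int \<Rightarrow> int)" where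
  "block_seq l f z i = f (z (i div int l)) ! nat (i mod int l)"

lemma length_subst: "(\<And>a. a \<in> set w \<Longrightarrow> length (f a) = l) \<Longrightarrow> length (subst f w) = length w * l"
  by (induction w) auto

lemma nth_subst:
  assumes "\<And>a. a \<in> set w \<Longrightarrow> length (f a) = l" "i < length w * l"
  shows "subst f w ! i = f (w ! (i div l)) ! (i mod l)"
  using assms
proof (induction w arbitrary: i)
  case (Cons a w)
  show ?case
  proof (cases "i < l")
    case True
    then show ?thesis using Cons.prems(1) by (simp add: nth_append)
  next
    case False
    then have "i - l < length w * l" "0 < l" using Cons.prems(2) by (auto, cases l) auto
    moreover have "i div l = Suc ((i - l) div l)" "i mod l = (i - l) mod l"
      using False \<open>0 < l\<close> by (auto simp: le_div_geq le_mod_geq)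
    ultimately show ?thesis
      using False Cons.prems(1) Cons.IH[of "i - l"] by (simp add: nth_append)
  qed
qed simp

lemma div_mod_add_mult:
  assumes "0 < l"
  shows "(p * int l + int k) div int l = p + int (k div l)"
    and "(p * int l + int k) mod int l = int (k mod l)"
  using assms by (simp_all add: zdiv_int zmod_int)

lemma subst_subst: "subst f (subst g s) = subst (\<lambda>a. subst f (g a)) s"
  by (induction s) simp_all

lemma take_subst: "(\<And>a. a \<in> set s \<Longrightarrow> length (f a) = l) \<Longrightarrow> take (k * l) (subst f s) = subst f (take k s)"
proof (induction s arbitrary: k)
  case (Cons a s)
  then show ?case by (cases k) simp_all
qed simp

lemma drop_subst: "(\<And>a. a \<in> set s \<Longrightarrow> length (f a) = l) \<Longrightarrow> drop (k * l) (subst f s) = subst f (drop k s)"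
proof (induction s arbitrary: k)
  case (Cons a s)
  then show ?case by (cases k) simp_all
qed simp

lemma subst_inject:
  assumes "inj_on f A" "\<And>a. a \<in> A \<Longrightarrow> length (f a) = l" "0 < l" "set s \<subseteq> A" "set t \<subseteq> A" "subst f s = subst f t"
  shows "s = t"
  using assms(4-6)
proof (induction s arbitrary: t)
  case Nil
  then show ?case using assms(2,3) by (cases t) force+
next
  case (Cons a s)
  from Cons.prems assms(2,3) obtain b t' where t: "t = b # t'" by (cases t) force+
  then have "length (f a) = length (f b)" using Cons.prems assms(2) by simp
  then have "f a = f b" "subst f s = subst f t'" using Cons.prems t by auto
  then show ?case using Cons t assms(1) by (auto dest: inj_onD)
qed

lemma length_subst_ge: "(\<And>a. f a \<noteq> []) \<Longrightarrow> length s \<le> length (subst f s)"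
proof (induction s)
  case (Cons a s)
  have "1 + length s \<le> length (f a) + length (subst f s)"
    using Cons by (intro add_mono) (simp_all add: Suc_le_eq)
  then show ?case by simp
qed simp

lemma window_block_seq:
  assumes z: "z \<in> full_shift A" and len: "\<And>a. a \<in> A \<Longrightarrow> length (f a) = l"
  shows "window (block_seq l f z) (p * int l) (n * l) = subst f (window z p n)"
proof (rule nth_equalityI)
  have set: "a \<in> set (window z p n) \<Longrightarrow> length (f a) = l" for a
    using len z by (auto simp: window_def full_shift_def)
  then show "length (window (block_seq l f z) (p * int l) (n * l)) = length (subst f (window z p n))"
    by (simp add: length_subst)
  fix k assume "k < length (window (block_seq l f z) (p * int l) (n * l))"
  then have k: "k < n * l" by simp
  then have "0 < l" "k div l < n" by (cases l, auto simp: less_mult_imp_div_less)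
  then show "window (block_seq l f z) (p * int l) (n * l) ! k = subst f (window z p n) ! k"
    using k set by (simp add: nth_subst block_seq_def flip: zdiv_int zmod_int)
qed

lemma block_seq_window_cong:
  assumes "window x p N = window z j N" "r + n \<le> N * l"
  shows "window (block_seq l f x) (p * int l + int r) n = window (block_seq l f z) (j * int l + int r) n"
  unfolding window_eq_iff
proof (intro allI impI)
  fix k assume "k < n"
  then have k: "r + k < N * l" using assms(2) by simp
  then have l: "0 < l" "(r + k) div l < N" by (cases l, auto simp: less_mult_imp_div_less)
  have "x (p + int ((r + k) div l)) = z (j + int ((r + k) div l))"
    using assms(1) l(2) unfolding window_eq_iff by blast
  then show "block_seq l f x (p * int l + int r + int k) = block_seq l f z (j * int l + int r + int k)"
    using div_mod_add_mult[OF l(1), of p "r + k"] div_mod_add_mult[OF l(1), of j "r + k"]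
    by (simp add: block_seq_def add.assoc)
qed

lemma translate_block_seq:
  assumes "0 < l"
  shows "translate (k * int l) (block_seq l f z) = block_seq l f (translate k z)"
  using assms by (simp add: fun_eq_iff block_seq_def translate_def add.commute)

lemma block_seq_inject:
  assumes "z \<in> full_shift A" "z' \<in> full_shift A" "\<And>a. a \<in> A \<Longrightarrow> length (f a) = l" "inj_on f A"
    "block_seq l f z = block_seq l f z'"
  shows "z = z'"
proof
  fix i
  have "f (z i) = f (z' i)"
    using window_block_seq[OF assms(1), of f l i 1] window_block_seq[OF assms(2), of f l i 1] assms(3,5)
    by (simp add: window_def)
  moreover have "z i \<in> A" "z' i \<in> A" using assms(1,2) by (auto simp: full_shift_def)
  ultimately show "z i = z' i" using assms(4) by (auto dest: inj_onD)
qed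

lemma morphism_seq_subst:
  assumes z: "z \<in> full_shift A" and len: "\<And>a. a \<in> A \<Longrightarrow> length (f a) = l" and l: "0 < l"
  shows "morphism_seq (subst f) z = block_seq l f z"
proof
  fix i
  have set: "a \<in> set (window z p n) \<Longrightarrow> length (f a) = l" for a p n
    using len z by (auto simp: window_def full_shift_def)
  show "morphism_seq (subst f) z i = block_seq l f z i"
  proof (cases "0 \<le> i")
    case True
    define k where "k = nat i"
    have i: "i = int k" using True by (simp add: k_def)
    have "k < (k + 1) * l" using l by (cases l) auto
    moreover have "k div l < k + 1" by (simp add: le_imp_less_Suc)
    ultimately show ?thesis
      unfolding morphism_seq_def block_seq_def i
      using nth_subst[of "window z 0 (k + 1)" f l k] set
      by (simp flip: zdiv_int zmod_int)
  next
    case False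
    define k where "k = nat (- i - 1)"
    have i: "i = - int (Suc k)" using False by (simp add: k_def)
    let ?w = "subst f (window z i (Suc k))"
    have w: "length ?w = Suc k * l" using length_subst[of "window z i (Suc k)" f l] set by simp
    have kl: "Suc k \<le> Suc k * l" using l mult_le_mono2[of 1 l "Suc k"] by simp
    define j where "j = Suc k * l - Suc k"
    have j: "j < Suc k * l" "int j = int (Suc k) * int l + i" using kl i l by (auto simp: j_def of_nat_diff algebra_simps)
    have "morphism_seq (subst f) z i = rev ?w ! k"
    proof -
      have "nat (- i) = Suc k" "nat (- i - 1) = k" using False by (auto simp: k_def)
      then show ?thesis using False by (simp only: morphism_seq_def if_False)
    qed
    also have "\<dots> = ?w ! j" using kl w by (simp add: rev_nth j_def)
    also have "\<dots> = f (window z i (Suc k) ! (j div l)) ! (j mod l)"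
      using nth_subst[of "window z i (Suc k)" f l j] set j(1) by (simp only: length_window)
    also have "window z i (Suc k) ! (j div l) = z (i + int (j div l))"
      using j(1) l by (intro nth_window) (simp add: less_mult_imp_div_less)
    also have "i + int (j div l) = i + (int (Suc k) + i div int l)"
      using l unfolding zdiv_int j(2) by simp
    also have "\<dots> = i div int l" using i by simp
    also have "j mod l = nat (i mod int l)"
      using l arg_cong[OF j(2), of "\<lambda>x. x mod int l"] by (simp flip: zmod_int)
    finally show ?thesis by (simp add: block_seq_def)
  qed
qed

lemma block_seq_in_full_shift:
  assumes "z \<in> full_shift A" "\<And>a. a \<in> A \<Longrightarrow> set (f a) \<subseteq> B" "\<And>a. a \<in> A \<Longrightarrow> length (f a) = l" "0 < l"
  shows "block_seq l f z \<in> full_shift B"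
proof -
  have "f (z (i div int l)) ! nat (i mod int l) \<in> B" for i
  proof -
    have "z (i div int l) \<in> A" using assms(1) by (auto simp: full_shift_def)
    moreover have "nat (i mod int l) < l" using assms(4) by (simp add: nat_less_iff)
    ultimately show ?thesis using assms(2,3) nth_mem by (metis subsetD)
  qed
  then show ?thesis by (auto simp: full_shift_def block_seq_def)
qed

lemma block_seq_cong:
  assumes "z \<in> full_shift A" "\<And>a. a \<in> A \<Longrightarrow> f a = g a"
  shows "block_seq l f z = block_seq l g z"
  using assms by (auto simp: block_seq_def full_shift_def fun_eq_iff image_subset_iff)

text \<open>Position \<open>i\<close> lies in the long block number \<open>i div (l * q)\<close>, and in its short block number
  \<open>i div l mod q\<close>.\<close>

lemma block_seq_compose:
  assumes z: "z \<in> full_shift A" and q: "\<And>a. a \<in> A \<Longrightarrow> length (g a) = q" "0 < q"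
    and l: "\<And>a b. a \<in> A \<Longrightarrow> b \<in> set (g a) \<Longrightarrow> length (f b) = l" "0 < l"
  shows "block_seq l f (block_seq q g z) = block_seq (l * q) (\<lambda>a. subst f (g a)) z"
proof
  fix i
  let ?a = "z (i div int (l * q))"
  have a: "?a \<in> A" using z by (auto simp: full_shift_def)
  define s where "s = nat (i mod int (l * q))"
  have s: "int s = i mod int (l * q)" "s < l * q" using q(2) l(2) by (auto simp: s_def nat_less_iff)
  have "i mod (int l * int q) = int l * (i div int l mod int q) + i mod int l"
    by (rule zmod_zmult2_eq) simp
  then have s': "int s = int l * (i div int l mod int q) + i mod int l" using s(1) by simp
  have "int (s div l) = i div int l mod int q" unfolding zdiv_int s' using l(2) by simp
  then have d: "s div l = nat (i div int l mod int q)" by simp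
  have "int (s mod l) = i mod int l" unfolding zmod_int s' using l(2) by simp
  then have m: "s mod l = nat (i mod int l)" by simp
  have "block_seq (l * q) (\<lambda>a. subst f (g a)) z i = subst f (g ?a) ! s"
    by (simp add: block_seq_def s_def)
  also have "\<dots> = f (g ?a ! (s div l)) ! (s mod l)"
    using nth_subst[of "g ?a" f l s] l(1)[OF a] q(1)[OF a] s(2) by (simp add: mult.commute)
  also have "\<dots> = block_seq l f (block_seq q g z) i"
    unfolding d m block_seq_def by (simp add: zdiv_zmult2_eq)
  finally show "block_seq l f (block_seq q g z) i = block_seq (l * q) (\<lambda>a. subst f (g a)) z i" ..
qed

section \<open>Codings with a marker\<close>

definition occurs_at :: "int list \<Rightarrow> (int \<Rightarrow> int) \<Rightarrow> int \<Rightarrow> bool" where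
  "occurs_at m y t \<longleftrightarrow> window y t (length m) = m"

lemma occurs_at_translate [simp]: "occurs_at m (translate k y) t \<longleftrightarrow> occurs_at m y (t + k)"
  by (simp add: occurs_at_def)

lemma occurs_at_prefix: "occurs_at m' y t \<Longrightarrow> prefix m m' \<Longrightarrow> occurs_at m y t"
  unfolding occurs_at_def prefix_def
  by (metis append_eq_append_conv length_append length_window window_add)

text \<open>All conditions on \<open>Y\<close> concern its words of the one length \<open>|m| + l\<close>, so a coding passes to every subshift with
  the same words of this length. The step condition is an equivalence in order to propagate
  occurrences of the marker to the left as well as to the right.\<close>

locale marked_coding =
  fixes A :: "int set" and f :: "int \<Rightarrow> int list" and l :: nat and m :: "int list"
    and Y :: "(int \<Rightarrow> int) set"
  assumes finite_alphabet: "finite A" and alphabet_nonempty: "A \<noteq> {}" and l_pos: "0 < l"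
    and length_block: "\<And>a. a \<in> A \<Longrightarrow> length (f a) = l" and inj_block: "inj_on f A"
    and marker_step: "\<And>w. w \<in> language (length m + l) Y \<Longrightarrow> take (length m) w = m \<longleftrightarrow> drop l w = m"
    and marker_isolated: "\<And>w j. w \<in> language (length m + l) Y \<Longrightarrow> take (length m) w = m \<Longrightarrow>
          0 < j \<Longrightarrow> j < l \<Longrightarrow> take (length m) (drop j w) \<noteq> m"
    and marker_block: "\<And>w. w \<in> language (length m + l) Y \<Longrightarrow> take (length m) w = m \<Longrightarrow> take l w \<in> f ` A"
    and block_used: "\<And>a. a \<in> A \<Longrightarrow> \<exists>w \<in> language (length m + l) Y. take (length m) w = m \<and> take l w = f a"

lemma marked_coding_cong_language:
  "language (length m + l) Y' = language (length m + l) Y \<Longrightarrow>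
    marked_coding A f l m Y' \<longleftrightarrow> marked_coding A f l m Y"
  by (simp add: marked_coding_def)

text \<open>The sequences of block names that spell points of \<open>Y\<close>. The marker at the origin fixes the phase: the
  blocks start where the marker occurs.\<close>

definition decoded ::
  "int set \<Rightarrow> (int \<Rightarrow> int list) \<Rightarrow> nat \<Rightarrow> int list \<Rightarrow> (int \<Rightarrow> int) set \<Rightarrow> (int \<Rightarrow> int) set" where
  "decoded A f l m Y =
     {z \<in> full_shift A. block_seq l f z \<in> Y \<and> occurs_at m (block_seq l f z) 0}"

context marked_coding
begin

lemma occurs_step: "y \<in> Y \<Longrightarrow> occurs_at m y t \<longleftrightarrow> occurs_at m y (t + int l)"
  using marker_step[OF window_in_language, of y t]
  by (simp add: take_window drop_window occurs_at_def)

lemma occurs_isolated: "y \<in> Y \<Longrightarrow> occurs_at m y t \<Longrightarrow> 0 < j \<Longrightarrow> j < l \<Longrightarrow> \<not> occurs_at m y (t + int j)"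
  using marker_isolated[OF window_in_language, of y t j]
  by (simp add: take_drop_window take_window occurs_at_def)

lemma occurs_block: "y \<in> Y \<Longrightarrow> occurs_at m y t \<Longrightarrow> window y t l \<in> f ` A"
  using marker_block[OF window_in_language, of y t]
  by (simp add: take_window occurs_at_def)

lemma occurs_iff:
  assumes y: "y \<in> Y" and t: "occurs_at m y t"
  shows "occurs_at m y s \<longleftrightarrow> int l dvd s - t"
proof -
  have k: "occurs_at m y (t + k * int l)" for k
  proof (induction k rule: int_induct[where k = 0])
    case (step1 k)
    then show ?case using occurs_step[OF y, of "t + k * int l"] by (simp add: algebra_simps)
  next
    case (step2 k)
    then show ?case using occurs_step[OF y, of "t + (k - 1) * int l"] by (simp add: algebra_simps)
  qed (use t in simp)
  show ?thesis
  proof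
    assume s: "occurs_at m y s"
    define j where "j = nat ((s - t) mod int l)"
    have j: "j < l" "s = t + (s - t) div int l * int l + int j" using l_pos by (auto simp: j_def nat_less_iff)
    then have "j = 0" using occurs_isolated[OF y k _ j(1)] s by (metis gr0I)
    then have "(s - t) mod int l = 0" using l_pos using l_pos pos_mod_sign[of "int l" "s - t"] unfolding j_def by linarith
    then show "int l dvd s - t" by auto
  next
    assume "int l dvd s - t"
    then obtain d where "s = t + d * int l" by (metis add.commute diff_add_cancel dvd_div_mult_self)
    then show "occurs_at m y s" using k by simp
  qed
qed

lemma marker_in_language: "m \<in> language (length m) Y"
proof -
  obtain a where "a \<in> A" using alphabet_nonempty by blast
  then obtain w where w: "w \<in> language (length m + l) Y" "take (length m) w = m" using block_used by blast
  show ?thesis using subword_of_language[OF w(1), of 0 "length m"] w(2) by simp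
qed

lemma decodedD:
  assumes "z \<in> decoded A f l m Y"
  shows "z \<in> full_shift A" "block_seq l f z \<in> Y" "occurs_at m (block_seq l f z) 0"
  using assms by (auto simp: decoded_def)

lemma decode:
  assumes sub: "Y \<in> subshifts" and y: "y \<in> Y" and t: "occurs_at m y t"
  obtains z where "z \<in> decoded A f l m Y" "translate t y = block_seq l f z"
proof -
  let ?y = "translate t y"
  have y': "?y \<in> Y" using translate_in_subshift[OF sub y] .
  have occ: "occurs_at m ?y (i * int l)" for i using occurs_iff[OF y t, of "i * int l + t"] by simp
  then have "\<exists>a\<in>A. window ?y (i * int l) l = f a" for i using occurs_block[OF y'] by blast
  then obtain z where z: "\<And>i. z i \<in> A" "\<And>i. window ?y (i * int l) l = f (z i)" by metis
  have "?y i = block_seq l f z i" for i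
  proof -
    have "nat (i mod int l) < l" using l_pos by (simp add: nat_less_iff)
    then have "block_seq l f z i = ?y (i div int l * int l + int (nat (i mod int l)))"
      unfolding block_seq_def z(2)[symmetric] by (rule nth_window)
    then show ?thesis using l_pos by simp
  qed
  then have eq: "?y = block_seq l f z" by (rule ext)
  have "occurs_at m ?y 0" using occ[of 0] by simp
  then have "z \<in> decoded A f l m Y" using z(1) y' unfolding decoded_def eq by (auto simp: full_shift_def)
  then show thesis using that eq by blast
qed

lemma decoded_inject:
  "z \<in> full_shift A \<Longrightarrow> z' \<in> full_shift A \<Longrightarrow> block_seq l f z = block_seq l f z' \<Longrightarrow> z = z'"
  using block_seq_inject length_block inj_block by blast

lemma decoded_marker: "z \<in> decoded A f l m Y \<Longrightarrow> occurs_at m (block_seq l f z) (i * int l)"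
  using occurs_iff decodedD(2,3) by fastforce

text \<open>Windows of \<open>x\<close> spell windows of \<open>block_seq l f x\<close>, and \<open>Y\<close> contains every sequence whose windows are words of
  \<open>Y\<close>.\<close>

lemma decoded_if_windows:
  assumes sub: "Y \<in> subshifts"
    and w: "\<And>i n. \<exists>z \<in> decoded A f l m Y. \<exists>j. window x i n = window z j n"
  shows "x \<in> decoded A f l m Y"
proof -
  have "x i \<in> A" for i
  proof -
    obtain z j where "z \<in> decoded A f l m Y" "window x i 1 = window z j 1" using w by blast
    then have "z \<in> full_shift A" "x i = z j" using decodedD(1) by (auto simp: window_eq_iff)
    then show ?thesis by (auto simp: full_shift_def)
  qed
  then have "x \<in> full_shift A" by (auto simp: full_shift_def)
  moreover have "block_seq l f x \<in> Y"
  proof (rule in_subshift_if_windows[OF sub])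
    fix i n
    define p r where "p = i div int l" and "r = nat (i mod int l)"
    have i: "i = p * int l + int r" and r: "r < l" using l_pos by (auto simp: p_def r_def nat_less_iff)
    have "n * 1 \<le> n * l" using l_pos by (intro mult_le_mono2) simp
    then have le: "r + n \<le> (n + 1) * l" using r by (simp add: add_mono)
    obtain z j where z: "z \<in> decoded A f l m Y" "window x p (n + 1) = window z j (n + 1)" using w by blast
    show "window (block_seq l f x) i n \<in> language n Y"
      unfolding i block_seq_window_cong[OF z(2) le] by (rule window_in_language[OF decodedD(2)[OF z(1)]])
  qed
  moreover have "occurs_at m (block_seq l f x) 0"
  proof -
    obtain z j where z: "z \<in> decoded A f l m Y" "window x 0 (length m) = window z j (length m)" using w by blast
    have "0 + length m \<le> length m * l" using l_pos by simp
    from block_seq_window_cong[OF z(2) this, of f] decoded_marker[OF z(1), of j] show ?thesis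
      by (simp add: occurs_at_def)
  qed
  ultimately show ?thesis by (simp add: decoded_def)
qed

lemma letter_decoded:
  assumes sub: "Y \<in> subshifts" and a: "a \<in> A"
  obtains z where "z \<in> decoded A f l m Y" "z 0 = a"
proof -
  obtain w where w: "w \<in> language (length m + l) Y" "take (length m) w = m" "take l w = f a"
    using block_used[OF a] by blast
  obtain y where y: "y \<in> Y" "window y 0 (length m + l) = w" using language_at[OF sub w(1)] by blast
  have "occurs_at m y 0" "window y 0 l = f a" using w(2,3) unfolding y(2)[symmetric]
    by (simp_all add: take_window occurs_at_def)
  then obtain z where z: "z \<in> decoded A f l m Y" "translate 0 y = block_seq l f z"
    using decode[OF sub y(1)] by blast
  have "f (z 0) = f a"
    using window_block_seq[OF decodedD(1)[OF z(1)] length_block, where p = 0 and n = 1] z(2) \<open>window y 0 l = f a\<close>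
    by (simp add: window_def)
  moreover have "z 0 \<in> A" using decodedD(1)[OF z(1)] by (auto simp: full_shift_def)
  ultimately have "z 0 = a" using inj_block a by (auto dest: inj_onD)
  then show thesis using that z(1) by blast
qed

end

text \<open>The map \<open>\<sigma>\<close> spells new blocks by old ones. The premise about \<open>w\<close> says that \<open>f b\<close> and \<open>f c\<close> are consecutive
  blocks somewhere in \<open>Y\<close>. Demanding each such pair inside each new block makes the resulting directive sequence
  primitive and its blocks grow; the last line makes it proper, and the prefix condition makes
  the cuts of the new coding cuts of the old one.\<close>

definition refines ::
  "int set \<Rightarrow> (int \<Rightarrow> int list) \<Rightarrow> nat \<Rightarrow> int list \<Rightarrow> int set \<Rightarrow> (int \<Rightarrow> int list) \<Rightarrow> int list \<Rightarrow>
   (int \<Rightarrow> int list) \<Rightarrow> (int \<Rightarrow> int) set \<Rightarrow> bool" where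
  "refines A f l m A' f' m' \<sigma> Y \<longleftrightarrow>
     prefix m m' \<and>
     (\<forall>a\<in>A'. \<sigma> a \<in> lists A \<and> f' a = subst f (\<sigma> a) \<and>
        (\<forall>b\<in>A. \<forall>c\<in>A. \<forall>w\<in>language (length m + 2 * l) Y.
           take (length m) w = m \<and> take (2 * l) w = f b @ f c \<longrightarrow> sublist [b, c] (\<sigma> a))) \<and>
     (\<forall>a\<in>A'. \<forall>b\<in>A'. hd (\<sigma> a) = hd (\<sigma> b) \<and> last (\<sigma> a) = last (\<sigma> b))"

lemma refines_cong_language:
  "language (length m + 2 * l) Y' = language (length m + 2 * l) Y \<Longrightarrow>
    refines A f l m A' f' m' \<sigma> Y' \<longleftrightarrow> refines A f l m A' f' m' \<sigma> Y"
  by (simp add: refines_def)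

section \<open>A chain of codings makes a strong Toeplitz subshift\<close>

lemma block_morphism_Suc: "n \<le> N \<Longrightarrow> block_morphism \<tau> n (Suc N) u = block_morphism \<tau> n N (\<tau> N u)"
proof -
  have "foldr (\<circ>) gs h u = foldr (\<circ>) gs id (h u)" for gs and h :: "int list \<Rightarrow> int list"
    by (induction gs) simp_all
  then show "n \<le> N \<Longrightarrow> ?thesis" by (simp add: block_morphism_def)
qed

lemma block_morphism_rec: "n < N \<Longrightarrow> block_morphism \<tau> n N u = \<tau> n (block_morphism \<tau> (Suc n) N u)"
  by (simp add: block_morphism_def upt_conv_Cons)

lemma block_morphism_refl [simp]: "block_morphism \<tau> n n u = u"
  by (simp add: block_morphism_def)

lemma sublist_subst: "sublist u v \<Longrightarrow> sublist (subst f u) (subst f v)"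
  unfolding sublist_def by (metis concat_append map_append)

lemma sublist_window: "j + n \<le> N \<Longrightarrow> sublist (window x (i + int j) n) (window x i N)"
  using take_drop_window[of j n N x i] by (metis append_take_drop_id sublist_appendI)

lemma sublist_of_window:
  assumes "sublist u (window x i N)"
  obtains j where "u = window x j (length u)"
proof -
  obtain p s where ps: "window x i N = p @ u @ s" using assms by (auto simp: sublist_def)
  have "length p + length u \<le> N" using arg_cong[OF ps, of length] by simp
  then have "window x (i + int (length p)) (length u) = take (length u) (drop (length p) (window x i N))"
    by (simp add: take_drop_window)
  then show thesis using that ps by (simp add: eq_commute[of u])
qed

locale coding_chain =
  fixes Y :: "(int \<Rightarrow> int) set" and A :: "nat \<Rightarrow> int set" and f :: "nat \<Rightarrow> int \<Rightarrow> int list"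
    and l :: "nat \<Rightarrow> nat" and m :: "nat \<Rightarrow> int list" and \<sigma> :: "nat \<Rightarrow> int \<Rightarrow> int list"
  assumes minimal: "minimal_subshift Y"
    and coding: "\<And>n. marked_coding (A n) (f n) (l n) (m n) Y"
    and refines: "\<And>n. refines (A n) (f n) (l n) (m n) (A (Suc n)) (f (Suc n)) (m (Suc n)) (\<sigma> n) Y"
begin

text \<open>\<open>F n\<close> spells a point of \<open>Y\<close> from names of level \<open>n\<close>, and \<open>S n\<close> rewrites names of level \<open>n + 1\<close> into names of
  level \<open>n\<close>; the latter is the action on sequences of the morphism \<open>\<tau> n\<close> of the directive sequence.\<close>

abbreviation Z :: "nat \<Rightarrow> (int \<Rightarrow> int) set" where
  "Z n \<equiv> decoded (A n) (f n) (l n) (m n) Y"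

abbreviation F :: "nat \<Rightarrow> (int \<Rightarrow> int) \<Rightarrow> (int \<Rightarrow> int)" where
  "F n \<equiv> block_seq (l n) (f n)"

abbreviation \<tau> :: "nat \<Rightarrow> int list \<Rightarrow> int list" where
  "\<tau> n \<equiv> subst (\<sigma> n)"

definition q :: "nat \<Rightarrow> nat" where
  "q n = l (Suc n) div l n"

abbreviation S :: "nat \<Rightarrow> (int \<Rightarrow> int) \<Rightarrow> (int \<Rightarrow> int)" where
  "S n \<equiv> block_seq (q n) (\<sigma> n)"

lemma subshift: "Y \<in> subshifts"
  using minimal by (simp add: minimal_subshift_def)

lemma \<sigma>_lists: "a \<in> A (Suc n) \<Longrightarrow> set (\<sigma> n a) \<subseteq> A n"
  using refines[of n] by (auto simp: refines_def in_lists_conv_set)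

lemma f_Suc: "a \<in> A (Suc n) \<Longrightarrow> f (Suc n) a = subst (f n) (\<sigma> n a)"
  using refines[of n] by (auto simp: refines_def)

lemma length_\<sigma>_mult: "a \<in> A (Suc n) \<Longrightarrow> length (\<sigma> n a) * l n = l (Suc n)"
  using length_subst[of "\<sigma> n a" "f n" "l n"] \<sigma>_lists[of a n] f_Suc[of a n]
    marked_coding.length_block[OF coding] by (metis subsetD)

lemma length_\<sigma>: "a \<in> A (Suc n) \<Longrightarrow> length (\<sigma> n a) = q n"
  using length_\<sigma>_mult[of a n] marked_coding.l_pos[OF coding, of n] unfolding q_def
  by (metis nonzero_mult_div_cancel_right less_numeral_extra(3))

lemma l_Suc: "l (Suc n) = l n * q n"
proof -
  obtain a where "a \<in> A (Suc n)" using marked_coding.alphabet_nonempty[OF coding] by blast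
  then show ?thesis using length_\<sigma>_mult length_\<sigma> by (metis mult.commute)
qed

lemma q_pos: "0 < q n"
  using l_Suc[of n] marked_coding.l_pos[OF coding, of "Suc n"] by simp

lemma F_Suc:
  assumes z: "z \<in> full_shift (A (Suc n))"
  shows "F (Suc n) z = F n (S n z)"
proof -
  have "F (Suc n) z = block_seq (l n * q n) (\<lambda>a. subst (f n) (\<sigma> n a)) z"
    using block_seq_cong[OF z f_Suc] l_Suc by simp
  also have "\<dots> = F n (S n z)"
    using z length_\<sigma> q_pos \<sigma>_lists marked_coding.length_block[OF coding] marked_coding.l_pos[OF coding]
    by (intro block_seq_compose[symmetric]) blast+
  finally show ?thesis .
qed

lemma S_full_shift: "z \<in> full_shift (A (Suc n)) \<Longrightarrow> S n z \<in> full_shift (A n)"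
  by (rule block_seq_in_full_shift[OF _ \<sigma>_lists length_\<sigma> q_pos])

lemma pair_covered:
  assumes z: "z \<in> Z n" and a: "a \<in> A (Suc n)"
  shows "sublist [z i, z (i + 1)] (\<sigma> n a)"
proof -
  interpret marked_coding "A n" "f n" "l n" "m n" Y by (rule coding)
  let ?w = "window (F n z) (i * int (l n)) (length (m n) + 2 * l n)"
  have w: "?w \<in> language (length (m n) + 2 * l n) Y" by (rule window_in_language[OF decodedD(2)[OF z]])
  have "take (length (m n)) ?w = m n"
    using decoded_marker[OF z] by (simp add: take_window occurs_at_def)
  moreover have "take (2 * l n) ?w = f n (z i) @ f n (z (i + 1))"
    using window_block_seq[OF decodedD(1)[OF z] length_block, where p = i and n = 2]
    by (simp add: take_window) (simp add: window_def numeral_2_eq_2)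
  moreover have "z i \<in> A n" "z (i + 1) \<in> A n" using decodedD(1)[OF z] by (auto simp: full_shift_def)
  ultimately show ?thesis using refines[of n] a w unfolding refines_def by blast
qed

lemma letters_covered:
  assumes "a \<in> A (Suc n)"
  shows "A n \<subseteq> set (\<sigma> n a)"
proof
  fix b assume "b \<in> A n"
  then obtain z where "z \<in> Z n" "z 0 = b" using marked_coding.letter_decoded[OF coding subshift] by blast
  then show "b \<in> set (\<sigma> n a)" using pair_covered[of z n a 0] assms set_mono_sublist by fastforce
qed

lemma q_ge_2: "2 \<le> q n"
proof -
  obtain a b where a: "a \<in> A (Suc n)" "b \<in> A n" using marked_coding.alphabet_nonempty[OF coding] by blast
  obtain z where "z \<in> Z n" using marked_coding.letter_decoded[OF coding subshift a(2)] by blast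
  then have "sublist [z 0, z 1] (\<sigma> n a)" using pair_covered[of z n a 0] a by simp
  then show ?thesis using sublist_length_le length_\<sigma>[OF a(1)] by fastforce
qed

lemma S_decoded:
  assumes z: "z \<in> Z (Suc n)"
  shows "S n z \<in> Z n"
proof -
  note d = marked_coding.decodedD[OF coding z]
  have "prefix (m n) (m (Suc n))" using refines[of n] by (simp add: refines_def)
  then show ?thesis using d S_full_shift F_Suc occurs_at_prefix by (auto simp: decoded_def)
qed

text \<open>By minimality the marker of level \<open>n + 1\<close> occurs somewhere in \<open>F n z\<close>, and cutting there yields \<open>z'\<close>. This is
  also a cut of level \<open>n\<close>, because the new marker starts with the old one.\<close>

lemma S_onto:
  assumes z: "z \<in> Z n"
  obtains z' k where "z' \<in> Z (Suc n)" "z = translate k (S n z')"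
proof -
  interpret marked_coding "A n" "f n" "l n" "m n" Y by (rule coding)
  note d = decodedD[OF z]
  obtain t where t: "occurs_at (m (Suc n)) (F n z) t"
    using minimal_occurs[OF minimal d(2) marked_coding.marker_in_language[OF coding]]
    unfolding occurs_at_def by blast
  obtain z' where z': "z' \<in> Z (Suc n)" "translate t (F n z) = F (Suc n) z'"
    using marked_coding.decode[OF coding subshift d(2) t] by blast
  have "prefix (m n) (m (Suc n))" using refines[of n] by (simp add: refines_def)
  then have "occurs_at (m n) (F n z) t" using occurs_at_prefix t by blast
  then have "int (l n) dvd t" using occurs_iff[OF d(2,3)] by simp
  then obtain k where k: "t = k * int (l n)" by (metis dvd_def mult.commute)
  have "F n (translate k z) = F n (S n z')"
    using z'(2) F_Suc[OF marked_coding.decodedD(1)[OF coding z'(1)]]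
      translate_block_seq[OF l_pos, of k "f n" z] k by simp
  moreover have "translate k z \<in> full_shift (A n)" using d(1) by (auto simp: full_shift_def translate_def)
  moreover have "S n z' \<in> full_shift (A n)"
    using decodedD(1)[OF S_decoded[OF z'(1)]] .
  ultimately have "translate k z = S n z'" using decoded_inject by blast
  then have "z = translate (- k) (S n z')" by (metis add.left_inverse translate_0 translate_translate)
  then show thesis using that z'(1) by blast
qed

text \<open>Induction on the length of the window. If it is at least three, then, as the words \<open>\<sigma> n a\<close> have length at
  least two, the window lies in the image of a window shorter by one, a level up. Windows of
  length at most two are covered by the pair condition.\<close>

lemma window_covered:
  assumes "z \<in> Z n"
  shows "\<exists>N>n. \<exists>a\<in>A N. sublist (window z i L) (block_morphism \<tau> n N [a])"
  using assms
proof (induction L arbitrary: n z i rule: less_induct)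
  case (less L)
  show ?case
  proof (cases "L \<le> 2")
    case True
    obtain a where a: "a \<in> A (Suc n)" using marked_coding.alphabet_nonempty[OF coding] by blast
    have "sublist (window z (i + int 0) L) (window z i 2)" using True by (intro sublist_window) simp
    moreover have "window z i 2 = [z i, z (i + 1)]" by (simp add: window_def numeral_2_eq_2)
    ultimately have "sublist (window z i L) (\<sigma> n a)"
      using pair_covered[OF less.prems a, of i] sublist_order.order_trans by fastforce
    then show ?thesis using a by (intro exI[of _ "Suc n"]) (auto simp: block_morphism_rec)
  next
    case False
    obtain z' k where z': "z' \<in> Z (Suc n)" "z = translate k (S n z')" using S_onto[OF less.prems] .
    define p r where "p = (i + k) div int (q n)" and "r = nat ((i + k) mod int (q n))"
    have pr: "i + k = p * int (q n) + int r" and r: "r < q n"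
      using q_pos[of n] by (auto simp: p_def r_def nat_less_iff)
    obtain N a where N: "N > Suc n" "a \<in> A N"
      "sublist (window z' p (L - 1)) (block_morphism \<tau> (Suc n) N [a])"
      using less.IH[of "L - 1" z' "Suc n" p] z'(1) False by auto
    obtain L' where L: "L = L' + 3" using False by (metis add.commute le_Suc_ex not_less_eq_eq numeral_2_eq_2 numeral_3_eq_3)
    have "(L' + 1) * 2 \<le> (L' + 1) * q n" using q_ge_2 by (intro mult_le_mono2)
    then have "r + L \<le> (L - 1) * q n" using r by (simp add: L algebra_simps)
    then have "sublist (window (S n z') (p * int (q n) + int r) L) (window (S n z') (p * int (q n)) ((L - 1) * q n))"
      by (rule sublist_window)
    also have "window (S n z') (p * int (q n)) ((L - 1) * q n) = \<tau> n (window z' p (L - 1))"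
      using marked_coding.decodedD(1)[OF coding z'(1)] length_\<sigma> by (rule window_block_seq)
    finally have "sublist (window z i L) (\<tau> n (window z' p (L - 1)))" using z'(2) pr by simp
    then have "sublist (window z i L) (\<tau> n (block_morphism \<tau> (Suc n) N [a]))"
      using sublist_subst[OF N(3)] sublist_order.order_trans by blast
    then show ?thesis using N(1,2) by (intro exI[of _ N]) (auto simp: block_morphism_rec)
  qed
qed

lemma block_morphism_window:
  assumes "z \<in> Z (n + d)"
  shows "\<exists>z'\<in>Z n. block_morphism \<tau> n (n + d) (window z 0 k) =
           window z' 0 (length (block_morphism \<tau> n (n + d) (window z 0 k)))"
  using assms
proof (induction d arbitrary: z k)
  case (Suc d)
  let ?N = "n + d"
  have z: "z \<in> Z (Suc ?N)" using Suc.prems by simp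
  have "\<tau> ?N (window z 0 k) = window (S ?N z) (0 * int (q ?N)) (k * q ?N)"
    using window_block_seq[OF marked_coding.decodedD(1)[OF coding z] length_\<sigma>, where p = 0 and n = k] by simp
  then show ?case using Suc.IH[OF S_decoded[OF z], of "k * q ?N"] by (simp add: block_morphism_Suc)
qed auto

text \<open>Each letter of level \<open>N\<close> is the name of a block that is used, so its image of level \<open>n\<close> is a window of a point of
  \<open>Z n\<close>, and \<open>Z n\<close> is determined by its windows. The converse inclusion is \<open>window_covered\<close>.\<close>

lemma sadic_eq_decoded: "sadic_subshift A \<tau> n = Z n"
proof (intro equalityI subsetI)
  fix x assume "x \<in> Z n"
  then show "x \<in> sadic_subshift A \<tau> n"
    using window_covered marked_coding.decodedD(1)[OF coding] by (auto simp: sadic_subshift_def)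
next
  fix x assume x: "x \<in> sadic_subshift A \<tau> n"
  show "x \<in> Z n"
  proof (rule marked_coding.decoded_if_windows[OF coding subshift])
    fix i L
    obtain N a where N: "N > n" "a \<in> A N" "sublist (window x i L) (block_morphism \<tau> n N [a])"
      using x unfolding sadic_subshift_def by blast
    obtain z where z: "z \<in> Z N" "z 0 = a" using marked_coding.letter_decoded[OF coding subshift N(2)] .
    have a: "[a] = window z 0 1" using z(2) by (simp add: window_def)
    have "n + (N - n) = N" using N(1) by simp
    then obtain z' where z': "z' \<in> Z n" "sublist (window x i L) (window z' 0 (length (block_morphism \<tau> n N [a])))"
      using block_morphism_window[of z n "N - n" 1] z(1) N(3) unfolding a by metis
    obtain j where "window x i L = window z' j L" using sublist_of_window[OF z'(2)] by auto
    then show "\<exists>z\<in>Z n. \<exists>j. window x i L = window z j L" using z'(1) by blast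
  qed
qed

text \<open>The occurrences of the marker of level \<open>n + 1\<close> in \<open>F n x\<close> form a residue class modulo \<open>l (n + 1)\<close>, which
  determines \<open>k\<close>; as different names have different blocks, \<open>y\<close> is determined too.\<close>

lemma recognizable: "recognizable_seq A \<tau>"
  unfolding recognizable_seq_def sadic_eq_decoded
proof (intro allI ballI)
  fix n x
  interpret C: marked_coding "A (Suc n)" "f (Suc n)" "l (Suc n)" "m (Suc n)" Y by (rule coding)
  have F: "F n x = translate (int k * int (l n)) (F (Suc n) y)" and k: "k < q n"
    if "y \<in> Z (Suc n)" "k < length (\<tau> n [y 0])" "x = (shift ^^ k) (morphism_seq (\<tau> n) y)" for y k
  proof -
    have y: "y \<in> full_shift (A (Suc n))" using C.decodedD(1) that(1) .
    then have "y 0 \<in> A (Suc n)" by (auto simp: full_shift_def)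
    then show "k < q n" using that(2) length_\<sigma> by simp
    have "x = translate (int k) (S n y)"
      using that(3) morphism_seq_subst[OF y length_\<sigma> q_pos] by (simp add: funpow_shift)
    then show "F n x = translate (int k * int (l n)) (F (Suc n) y)"
      using F_Suc[OF y] translate_block_seq[OF marked_coding.l_pos[OF coding]] by simp
  qed
  have *: "y = y' \<and> k = k'"
    if y: "y \<in> Z (Suc n)" "k < q n" "F n x = translate (int k * int (l n)) (F (Suc n) y)"
      and y': "y' \<in> Z (Suc n)" "k' < q n" "F n x = translate (int k' * int (l n)) (F (Suc n) y')"
    for y k y' k'
  proof -
    have "translate (int k * int (l n)) (F (Suc n) y) = translate (int k' * int (l n)) (F (Suc n) y')"
      using y(3) y'(3) by simp
    from arg_cong[OF this, of "translate (- (int k * int (l n)))"]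
    have eq: "F (Suc n) y = translate ((int k' - int k) * int (l n)) (F (Suc n) y')"
      by (simp add: algebra_simps)
    have "occurs_at (m (Suc n)) (F (Suc n) y') ((int k' - int k) * int (l n))"
      using C.decodedD(3)[OF y(1)] unfolding eq by simp
    then have "int (l n) * int (q n) dvd int (l n) * (int k' - int k)"
      using C.occurs_iff[OF C.decodedD(2,3)[OF y'(1)]] l_Suc by (simp add: mult.commute)
    then have "int (q n) dvd int k' - int k"
      using marked_coding.l_pos[OF coding, of n] by simp
    moreover have "\<bar>int k' - int k\<bar> < int (q n)" using y(2) y'(2) by linarith
    ultimately have k: "k = k'" using dvd_imp_le_int[of "int k' - int k" "int (q n)"] by fastforce
    then have "F (Suc n) y = F (Suc n) y'" using eq by simp
    then show ?thesis using k C.decoded_inject C.decodedD(1) y(1) y'(1) by blast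
  qed
  show "Uniq (\<lambda>(y, k). y \<in> Z (Suc n) \<and> k < length (\<tau> n [y 0]) \<and> x = (shift ^^ k) (morphism_seq (\<tau> n) y))"
  proof (rule Uniq_I)
    fix p p' :: "(int \<Rightarrow> int) \<times> nat"
    obtain y k y' k' where p: "p = (y, k)" "p' = (y', k')" by (cases p, cases p')
    assume "case p of (y, k) \<Rightarrow> y \<in> Z (Suc n) \<and> k < length (\<tau> n [y 0]) \<and> x = (shift ^^ k) (morphism_seq (\<tau> n) y)"
      and "case p' of (y, k) \<Rightarrow> y \<in> Z (Suc n) \<and> k < length (\<tau> n [y 0]) \<and> x = (shift ^^ k) (morphism_seq (\<tau> n) y)"
    then have y: "y \<in> Z (Suc n)" "k < length (\<tau> n [y 0])" "x = (shift ^^ k) (morphism_seq (\<tau> n) y)"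
      and y': "y' \<in> Z (Suc n)" "k' < length (\<tau> n [y' 0])" "x = (shift ^^ k') (morphism_seq (\<tau> n) y')"
      unfolding p prod.case by blast+
    show "p = p'"
      using *[OF y(1) k[OF y] F[OF y] y'(1) k[OF y'] F[OF y']] unfolding p by simp
  qed
qed

lemma strong_toeplitz_if_rank:
  assumes base: "Z 0 = Y" and rank: "\<And>n. card (A (Suc n)) \<le> K"
  shows "strong_toeplitz K Y"
proof -
  have "directive_sequence A \<tau>"
    unfolding directive_sequence_def word_morphism_def
  proof (intro conjI allI ballI)
    fix n
    show "finite (A n)" by (rule marked_coding.finite_alphabet[OF coding])
    show "\<tau> n u \<in> lists (A n)" if "u \<in> lists (A (Suc n))" for u
      using \<sigma>_lists that by (fastforce simp: in_lists_conv_set)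
    show "\<tau> n [a] \<noteq> []" if "a \<in> A (Suc n)" for a
      using length_\<sigma>[OF that] q_pos[of n] by auto
  qed simp
  moreover have "constant_length_seq A \<tau>" by (simp add: constant_length_seq_def length_\<sigma>)
  moreover have "primitive_seq A \<tau>"
    unfolding primitive_seq_def
  proof
    fix n
    show "\<exists>N>n. \<forall>a\<in>A N. A n \<subseteq> set (block_morphism \<tau> n N [a])"
      using letters_covered by (intro exI[of _ "Suc n"]) (simp add: block_morphism_rec)
  qed
  moreover have "proper_seq A \<tau>"
    unfolding proper_seq_def
  proof (intro allI ballI)
    fix n a b assume "a \<in> A (Suc n)" "b \<in> A (Suc n)"
    then have "hd (\<sigma> n a) = hd (\<sigma> n b) \<and> last (\<sigma> n a) = last (\<sigma> n b)"
      using refines[of n] unfolding refines_def by blast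
    then show "hd (\<tau> n [a]) = hd (\<tau> n [b]) \<and> last (\<tau> n [a]) = last (\<tau> n [b])" by simp
  qed
  moreover have "alphabet_rank A \<le> enat K"
    unfolding alphabet_rank_def
  proof (rule Liminf_le)
    show "\<forall>\<^sub>F n in sequentially. enat (card (A n)) \<le> enat K"
    proof (rule eventually_sequentiallyI)
      fix n :: nat assume "1 \<le> n"
      then show "enat (card (A n)) \<le> enat K" using rank[of "n - 1"] by simp
    qed
  qed simp
  moreover have "conjugate_subshifts Y (sadic_subshift A \<tau> 0)"
    unfolding sadic_eq_decoded base conjugate_subshifts_def
    by (intro exI[of _ id]) (simp add: homeomorphism_def)
  ultimately show ?thesis using subshift recognizable unfolding strong_toeplitz_def by blast
qed

end

section \<open>Return words\<close>

lemma prefix_append_shorter: "prefix u (v @ w) \<Longrightarrow> length u \<le> length v \<Longrightarrow> prefix u v"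
  by (metis prefix_length_prefix prefix_def)

text \<open>The word \<open>r a @ w\<close> starts and ends with \<open>w\<close> and does not contain it anywhere else: \<open>r a\<close> is a first return
  to \<open>w\<close>.\<close>

locale return_words =
  fixes w :: "'b list" and r :: "'a \<Rightarrow> 'b list"
  assumes starts: "\<And>a. prefix w (r a @ w)"
    and nonempty: "\<And>a. r a \<noteq> []"
    and first_return: "\<And>a j. 0 < j \<Longrightarrow> j < length (r a) \<Longrightarrow> take (length w) (drop j (r a @ w)) \<noteq> w"
    and distinct: "inj r"
begin

lemma prefix_w: "prefix w (subst r s @ w)"
proof (induction s)
  case (Cons a s)
  then obtain x where "subst r s @ w = w @ x" by (auto simp: prefix_def)
  then have "subst r (a # s) @ w = (r a @ w) @ x" by simp
  then show ?case using starts prefix_prefix by metis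
qed simp

lemma prefix_w_long: "length w \<le> length s \<Longrightarrow> prefix w (subst r s)"
  using prefix_append_shorter[OF prefix_w] length_subst_ge[of r s] nonempty by simp

text \<open>What follows a return word starts with \<open>w\<close>. Hence an occurrence of \<open>w\<close> that starts inside
  \<open>r a\<close> ends inside \<open>r a @ w\<close>, which the first return excludes unless it starts at the very beginning.\<close>

lemma occurrence_at_boundary:
  assumes "take (length w) (drop t (subst r s @ w)) = w" "t \<le> length (subst r s)"
  shows "\<exists>j\<le>length s. t = length (subst r (take j s))"
  using assms
proof (induction s arbitrary: t)
  case (Cons a s)
  consider "t = 0" | "0 < t" "t < length (r a)" | "length (r a) \<le> t" by linarith
  then show ?case
  proof cases
    case 1
    then show ?thesis by (intro exI[of _ 0]) simp
  next
    case 2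
    obtain x where x: "subst r s @ w = w @ x" using prefix_w by (auto simp: prefix_def)
    have "drop t (subst r (a # s) @ w) = drop t (r a @ w) @ x"
      using x 2 by simp
    then have "take (length w) (drop t (r a @ w)) = w" using Cons.prems(1) 2 by simp
    then show ?thesis using first_return 2 by blast
  next
    case 3
    have "\<exists>j\<le>length s. t - length (r a) = length (subst r (take j s))"
      by (rule Cons.IH) (use Cons.prems 3 in auto)
    then obtain j where "j \<le> length s" "t - length (r a) = length (subst r (take j s))" by blast
    then show ?thesis using 3 by (intro exI[of _ "Suc j"]) simp
  qed
qed simp

text \<open>If two return words followed by \<open>w\<close> are prefixes of the same word, then they coincide, since otherwise
  \<open>w\<close> would occur inside the longer one.\<close>

lemma prefix_decode: "prefix (subst r u @ w) (subst r s @ w) \<Longrightarrow> prefix u s"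
proof (induction u arbitrary: s)
  case (Cons a u)
  have "0 < length (r a)" using nonempty by simp
  then obtain b s' where s: "s = b # s'"
    using prefix_length_le[OF Cons.prems] by (cases s) auto
  have pre: "prefix (r c @ w) (subst r (c # v) @ w)" for c v using prefix_w by simp
  have *: "\<not> length (r c) < length (r d)"
    if "prefix (r c @ w) x" "prefix (r d @ w) x" for c d x
  proof
    assume less: "length (r c) < length (r d)"
    then have "prefix (r c @ w) (r d @ w)" using that by (intro prefix_length_prefix[OF that]) simp
    then obtain v where "r d @ w = r c @ w @ v" by (auto simp: prefix_def)
    then have "drop (length (r c)) (r d @ w) = w @ v" by (simp only:) simp
    then have "take (length w) (drop (length (r c)) (r d @ w)) = w" by (simp only:) simp
    then show False using first_return[OF _ less] nonempty[of c] by simp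
  qed
  have ab: "prefix (r a @ w) (subst r s @ w)" "prefix (r b @ w) (subst r s @ w)"
    using prefix_order.order_trans[OF pre Cons.prems] pre unfolding s by blast+
  then have "length (r a) = length (r b)" using *[OF ab] *[OF ab(2,1)] by simp
  moreover from this have "r a @ w = r b @ w"
    using ab by (metis length_append prefix_length_prefix prefix_order.antisym order_refl)
  ultimately have "a = b" using distinct by (simp add: inj_eq)
  then show ?case using Cons.IH[of s'] Cons.prems s by simp
qed simp

lemma marker_occurrence:
  assumes "take (length (subst r u @ w)) (drop t (subst r s @ w)) = subst r u @ w"
    "t \<le> length (subst r s)"
  obtains j where "t = length (subst r (take j s))" "prefix u (drop j s)"
proof -
  obtain x where x: "drop t (subst r s @ w) = subst r u @ w @ x"
    using assms(1) by (metis append.assoc append_take_drop_id)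
  obtain x' where "subst r u @ w = w @ x'" using prefix_w by (auto simp: prefix_def)
  then have "drop t (subst r s @ w) = w @ x' @ x" using x by simp
  then have "take (length w) (drop t (subst r s @ w)) = w" by simp
  then obtain j where j: "j \<le> length s" "t = length (subst r (take j s))"
    using occurrence_at_boundary assms(2) by blast
  have "subst r s @ w = subst r (take j s) @ subst r (drop j s) @ w"
    by (metis append.assoc append_take_drop_id concat_append map_append)
  then have "drop t (subst r s @ w) = subst r (drop j s) @ w" using j(2) by simp
  then have "prefix (subst r u @ w) (subst r (drop j s) @ w)" using x by (simp add: prefix_def)
  then show thesis using that j(2) prefix_decode by blast
qed

text \<open>A word no longer than \<open>w\<close> that starts inside \<open>r a\<close> ends inside \<open>r a @ w\<close>.\<close>

lemma factor_local:
  assumes "n \<le> length w" "t + n \<le> length (subst r s @ w)"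
  shows "\<exists>a. sublist (take n (drop t (subst r s @ w))) (r a @ w)"
  using assms(2)
proof (induction s arbitrary: t)
  case Nil
  have "sublist (take n (drop t w)) w" by (meson sublist_drop sublist_order.order_trans sublist_take)
  then have "sublist (take n (drop t w)) (r undefined @ w)"
    using sublist_order.order_trans sublist_append_leftI by blast
  then show ?case by auto
next
  case (Cons a s)
  show ?case
  proof (cases "t < length (r a)")
    case True
    obtain x where x: "subst r s @ w = w @ x" using prefix_w by (auto simp: prefix_def)
    have "drop t (subst r (a # s) @ w) = drop t (r a @ w) @ x" using x True by simp
    then have "take n (drop t (subst r (a # s) @ w)) = take n (drop t (r a @ w))"
      using True assms(1) by simp
    moreover have "sublist (take n (drop t (r a @ w))) (r a @ w)"
      by (meson sublist_drop sublist_order.order_trans sublist_take)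
    ultimately show ?thesis by metis
  next
    case False
    then have "drop t (subst r (a # s) @ w) = drop (t - length (r a)) (subst r s @ w)" by simp
    then show ?thesis using Cons.IH[of "t - length (r a)"] Cons.prems False by simp
  qed
qed

end

section \<open>Two blocks of equal length built from two return words\<close>

locale two_return_words = return_words w r for w :: "int list" and r :: "bool \<Rightarrow> int list"
begin

text \<open>At least \<open>|w|\<close>, so that a block starts with \<open>w\<close>, and at least \<open>3\<close> for \<open>pattern_sync\<close>.\<close>

definition K :: nat where "K = length w + 3"

text \<open>Both patterns contain \<open>K + 1\<close> times \<open>False\<close> and three times \<open>True\<close>, so the blocks spelled by them
  have the same length. Both start with the run of length \<open>K\<close>, and both have \<open>True\<close> at the positions \<open>K\<close>
  and \<open>K + 3\<close>, which leaves no room for a second run of this length.\<close>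

definition pattern :: "int \<Rightarrow> bool list" where
  "pattern a = replicate K False @ (if a = 0 then [True, False, True, True] else [True, True, False, True])"

definition block :: "int \<Rightarrow> int list" where
  "block a = subst r (pattern a)"

definition len :: nat where "len = length (block 0)"

definition marker :: "int list" where
  "marker = subst r (replicate K False) @ w"

lemma length_pattern [simp]: "length (pattern a) = K + 4"
  by (simp add: pattern_def)

lemma length_block [simp]: "length (block a) = len"
  by (simp add: block_def len_def pattern_def)

lemma len_pos: "0 < len"
  using nonempty by (simp add: len_def block_def pattern_def)

text \<open>A run of length \<open>K\<close> that starts inside a pattern would reach its position \<open>K\<close> or its position \<open>K + 3\<close>, and both
  carry \<open>True\<close>.\<close>

lemma pattern_sync:
  assumes "prefix (replicate K False) (drop j (subst pattern v))"
  shows "(K + 4) dvd j"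
proof (rule ccontr)
  assume "\<not> (K + 4) dvd j"
  define j0 where "j0 = j mod (K + 4)"
  have j0: "0 < j0" "j0 < K + 4" using \<open>\<not> (K + 4) dvd j\<close> by (auto simp: j0_def dvd_eq_mod_eq_0)
  obtain x where x: "drop j (subst pattern v) = replicate K False @ x"
    using assms by (auto simp: prefix_def)
  have len: "length (subst pattern v) = length v * (K + 4)" by (rule length_subst) simp
  have K: "K \<le> length (subst pattern v) - j" using arg_cong[OF x, of length] by simp
  have F: "\<not> pattern (v ! ((j + i) div (K + 4))) ! ((j + i) mod (K + 4))" if i: "i < K" for i
  proof -
    have ji: "j + i < length (subst pattern v)" using K i by simp
    have "subst pattern v ! (j + i) = drop j (subst pattern v) ! i" using ji by simp
    also have "\<dots> = False" using x i by (simp add: nth_append)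
    finally show ?thesis using nth_subst[of v pattern "K + 4" "j + i"] ji len by simp
  qed
  have T: "pattern a ! K" "pattern a ! (K + 3)" for a
    by (simp_all add: pattern_def nth_append numeral_3_eq_3)
  have m: "(j + i) mod (K + 4) = j0 + i" if "j0 + i < K + 4" for i
    using that unfolding j0_def by (metis mod_add_left_eq mod_less)
  show False
  proof (cases "j0 \<le> K")
    case True
    then show False using F[of "K - j0"] m[of "K - j0"] T(1) j0 by simp
  next
    case False
    then have "K + 3 - j0 < K" by (simp add: K_def)
    then show False using F[of "K + 3 - j0"] m[of "K + 3 - j0"] T(2) j0 by simp
  qed
qed

lemma w_prefix_block: "prefix w (block a)"
proof -
  have "prefix w (subst r (replicate K False))" by (rule prefix_w_long) (simp add: K_def)
  then show ?thesis by (simp add: block_def pattern_def)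
qed

lemma block_inj: "inj_on block {0, 1}"
proof -
  have "block 0 \<noteq> block 1"
  proof
    assume "block 0 = block 1"
    then have "prefix (pattern 0) (pattern 1)" by (intro prefix_decode) (simp add: block_def)
    then show False by (simp add: pattern_def)
  qed
  then show ?thesis by simp
qed

context
  fixes z :: "int \<Rightarrow> int"
begin

abbreviation x :: "int \<Rightarrow> int" where "x \<equiv> block_seq len block z"

lemma window_x: "window x (i * int len) (n * len) = subst r (subst pattern (window z i n))"
proof -
  have "z \<in> full_shift UNIV" by (simp add: full_shift_def)
  then have "window x (i * int len) (n * len) = subst block (window z i n)"
    by (rule window_block_seq) simp
  moreover have "subst r (subst pattern v) = subst block v" for v
    by (simp add: subst_subst block_def[abs_def])
  ultimately show ?thesis by simp
qed

lemma prefix_window_x: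
  "prefix (subst r (subst pattern (window z i n)) @ w)
     (window x (i * int len) ((n + length w) * len))"
proof -
  have "length w \<le> length (subst pattern (window z (i + int n) (length w)))"
    by (subst length_subst[where l = "K + 4"]) auto
  then show ?thesis unfolding window_x window_add using prefix_w_long by simp
qed

text \<open>An occurrence of the marker starts at a seam and is decoded there as a run of length \<open>K\<close>, which starts a
  pattern by \<open>pattern_sync\<close>. Conversely, a block starts with the run and goes on, through the
  seam after it, with \<open>w\<close>.\<close>

lemma marker_occurs_x: "occurs_at marker x t \<longleftrightarrow> int len dvd t"
proof
  assume occ: "occurs_at marker x t"
  define i k where "i = t div int len" and "k = nat (t mod int len)"
  have t: "t = i * int len + int k" and k: "k < len" using len_pos by (auto simp: i_def k_def nat_less_iff)
  let ?n = "length marker + 1"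
  let ?s = "subst pattern (window z i ?n)"
  have "length marker * 1 \<le> length marker * len" using len_pos by (intro mult_le_mono2) simp
  then have le: "k + length marker \<le> ?n * len" using k by (simp add: add_mono)
  have ls: "length (subst r ?s) = ?n * len"
    unfolding window_x[symmetric] by simp
  have "window x t (length marker) = take (length marker) (drop k (window x (i * int len) (?n * len)))"
    unfolding t using le by (simp only: take_drop_window)
  also have "\<dots> = take (length marker) (drop k (subst r ?s @ w))"
    unfolding window_x using le ls by simp
  finally have "take (length marker) (drop k (subst r ?s @ w)) = marker"
    using occ unfolding occurs_at_def by simp
  then obtain j where j: "k = length (subst r (take j ?s))" "prefix (replicate K False) (drop j ?s)"
    using marker_occurrence[of "replicate K False" k ?s] k ls unfolding marker_def[symmetric] by auto
  obtain d where "j = d * (K + 4)" using pattern_sync[OF j(2)] by (metis dvd_def mult.commute)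
  then have "take j ?s = subst pattern (take d (window z i ?n))"
    by (simp only:) (rule take_subst, simp)
  then have "k = length (window x (i * int len) (min d ?n * len))"
    using j(1) by (simp only: take_window window_x)
  then have "k = min d ?n * len" by simp
  then have "k = 0" using k by (cases "min d ?n") auto
  then show "int len dvd t" using t by simp
next
  assume "int len dvd t"
  then obtain i where t: "t = i * int len" by (metis dvd_def mult.commute)
  have "pattern (z i) = replicate K False @ drop K (pattern (z i))" by (simp add: pattern_def)
  from arg_cong[OF this, of "\<lambda>s. subst r s"]
  have "subst r (pattern (z i)) = subst r (replicate K False) @ subst r (drop K (pattern (z i)))"
    by (simp only: map_append concat_append)
  moreover have "subst pattern (window z i 1) = pattern (z i)" by (simp add: window_def)
  ultimately have "subst r (subst pattern (window z i 1)) =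
      subst r (replicate K False) @ subst r (drop K (pattern (z i)))" by (simp only:)
  then have "prefix marker (subst r (subst pattern (window z i 1)) @ w)"
    using prefix_w[of "drop K (pattern (z i))"] by (simp add: marker_def)
  then have "prefix marker (window x t ((1 + length w) * len))"
    using prefix_window_x[of i 1] t prefix_order.order_trans by blast
  then show "occurs_at marker x t"
    by (rule occurs_at_prefix[rotated]) (simp add: occurs_at_def)
qed

end

end

section \<open>Subshifts obtained by substituting blocks\<close>

definition spread :: "nat \<Rightarrow> (int \<Rightarrow> int list) \<Rightarrow> (int \<Rightarrow> int) set \<Rightarrow> (int \<Rightarrow> int) set" where
  "spread l f Z = {translate k (block_seq l f z) | z k. z \<in> Z}"

text \<open>Up to translates by less than \<open>l\<close> this is a continuous image of a compact set. Windows of concatenations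
  depend on windows of \<open>Z\<close>, and so minimality is inherited from \<open>Z\<close>.\<close>

lemma spread_minimal:
  assumes min: "minimal_subshift Z" and A: "finite A" "Z \<subseteq> full_shift A"
    and l: "0 < l" and len: "\<And>a. a \<in> A \<Longrightarrow> length (f a) = l"
  shows "minimal_subshift (spread l f Z)"
proof -
  have Z: "Z \<in> subshifts" using min by (simp add: minimal_subshift_def)
  have eq: "spread l f Z = (\<Union>k\<in>{..<l}. (\<lambda>z. translate (int k) (block_seq l f z)) ` Z)"
  proof (intro equalityI subsetI)
    fix y assume "y \<in> spread l f Z"
    then obtain z k where z: "z \<in> Z" "y = translate k (block_seq l f z)" by (auto simp: spread_def)
    define i j where "i = k div int l" and "j = nat (k mod int l)"
    have k: "k = int j + i * int l" and j: "j < l" using l by (auto simp: i_def j_def nat_less_iff)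
    have "y = translate (int j) (block_seq l f (translate i z))"
      using z(2) translate_block_seq[OF l, of i f z, symmetric] k by simp
    then show "y \<in> (\<Union>k\<in>{..<l}. (\<lambda>z. translate (int k) (block_seq l f z)) ` Z)"
      using j translate_in_subshift[OF Z z(1)] by blast
  qed (auto simp: spread_def)
  have "compact ((\<lambda>z. translate (int k) (block_seq l f z)) ` Z)" for k
    unfolding translate_def block_seq_def
    by (intro compact_continuous_image compact_subshift[OF Z] continuous_local_map)
  then have "closed (spread l f Z)" unfolding eq by (intro closed_if_compact compact_UN) auto
  moreover have "translate k y \<in> spread l f Z" if y: "y \<in> spread l f Z" for y k
  proof -
    obtain z j where "z \<in> Z" "y = translate j (block_seq l f z)" using y by (auto simp: spread_def)
    then have "translate k y = translate (k + j) (block_seq l f z)" by simp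
    then show ?thesis using \<open>z \<in> Z\<close> unfolding spread_def by blast
  qed
  then have "shift ` spread l f Z = spread l f Z" by (rule shift_image_eq)
  moreover have "spread l f Z \<subseteq> full_shift (\<Union>a\<in>A. set (f a))"
  proof
    fix y assume "y \<in> spread l f Z"
    then obtain z k where z: "z \<in> Z" "y = translate k (block_seq l f z)" by (auto simp: spread_def)
    have "block_seq l f z \<in> full_shift (\<Union>a\<in>A. set (f a))"
      using z(1) A(2) len l by (intro block_seq_in_full_shift[of z A]) auto
    then show "y \<in> full_shift (\<Union>a\<in>A. set (f a))" using z(2) by (auto simp: full_shift_def translate_def)
  qed
  moreover have "finite (\<Union>a\<in>A. set (f a))" using A(1) by simp
  ultimately have sub: "spread l f Z \<in> subshifts" unfolding subshifts_def by blast
  show ?thesis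
    unfolding minimal_subshift_iff[OF sub]
  proof (intro ballI allI)
    fix x n v assume "x \<in> spread l f Z" and "v \<in> language n (spread l f Z)"
    then obtain z k y i where z: "z \<in> Z" "x = translate k (block_seq l f z)"
      and y: "y \<in> Z" "v = window (block_seq l f y) i n"
      by (auto simp: spread_def language_def)
    define p s where "p = i div int l" and "s = nat (i mod int l)"
    have i: "i = p * int l + int s" and s: "s < l" using l by (auto simp: p_def s_def nat_less_iff)
    have "n * 1 \<le> n * l" using l by (intro mult_le_mono2) simp
    then have le: "s + n \<le> (n + 1) * l" using s by (simp add: add_mono)
    obtain j where "window z j (n + 1) = window y p (n + 1)"
      using minimal_occurs[OF min z(1) window_in_language[OF y(1)]] .
    from block_seq_window_cong[OF this le, of f]
    have "window x (j * int l + int s - k) n = v" unfolding z(2) y(2) i by simp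
    then show "\<exists>t. window x t n = v" ..
  qed
qed

lemma spread_infinite:
  assumes "infinite Z" "Z \<subseteq> full_shift A" "\<And>a. a \<in> A \<Longrightarrow> length (f a) = l" "inj_on f A"
  shows "infinite (spread l f Z)"
proof -
  have "inj_on (block_seq l f) Z"
    using block_seq_inject[of _ A _ f l] assms(2-4) by (intro inj_onI) blast
  then have "infinite (block_seq l f ` Z)" using assms(1) finite_imageD by blast
  moreover have "block_seq l f ` Z \<subseteq> spread l f Z"
    unfolding spread_def by (auto intro!: exI[of _ 0])
  ultimately show ?thesis using infinite_super by blast
qed

text \<open>A point is determined by the indicator sequences of the finitely many letters, so for some letter there are
  infinitely many indicator sequences. They form a factor of \<open>Y\<close>, hence a minimal subshift.\<close>

lemma binary_factor:
  assumes Y: "minimal_subshift Y" "infinite Y"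
  obtains Z where "minimal_subshift Z" "infinite Z" "Z \<subseteq> full_shift {0, 1}"
proof -
  have sub: "Y \<in> subshifts" using Y(1) by (simp add: minimal_subshift_def)
  obtain A where A: "finite A" "Y \<subseteq> full_shift A" using sub by (rule subshift_alphabet)
  define h where "h a y = (\<lambda>i. if y i = a then 1 else 0 :: int)" for a :: int and y :: "int \<Rightarrow> int"
  have "\<exists>a\<in>A. infinite (h a ` Y)"
  proof (rule ccontr)
    assume "\<not> ?thesis"
    then have "finite (PiE A (\<lambda>a. h a ` Y))" using A(1) by (intro finite_PiE) auto
    moreover have "(\<lambda>y. \<lambda>a\<in>A. h a y) ` Y \<subseteq> PiE A (\<lambda>a. h a ` Y)" by auto
    ultimately have "finite ((\<lambda>y. \<lambda>a\<in>A. h a y) ` Y)" by (rule finite_subset[rotated])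
    moreover have "inj_on (\<lambda>y. \<lambda>a\<in>A. h a y) Y"
    proof (rule inj_onI, rule ext)
      fix y y' i assume y: "y \<in> Y" "y' \<in> Y" and eq: "(\<lambda>a\<in>A. h a y) = (\<lambda>a\<in>A. h a y')"
      have "y i \<in> A" using y(1) A(2) by (auto simp: full_shift_def)
      then have "h (y i) y i = h (y i) y' i" using fun_cong[OF eq, of "y i"] by simp
      then show "y i = y' i" by (simp add: h_def split: if_splits)
    qed
    ultimately show False using Y(2) finite_imageD by blast
  qed
  then obtain a where a: "infinite (h a ` Y)" by blast
  have tr: "translate k (h a y) = h a (translate k y)" for k y by (simp add: h_def translate_def)
  have win: "window (h a y) i n = map (\<lambda>b. if b = a then 1 else 0) (window y i n)" for y i n
    by (simp add: window_def h_def)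
  have "compact (h a ` Y)"
    unfolding h_def by (intro compact_continuous_image compact_subshift[OF sub] continuous_local_map[where c = "\<lambda>i. i"])
  then have "closed (h a ` Y)" by (rule closed_if_compact)
  moreover have "translate k y \<in> h a ` Y" if "y \<in> h a ` Y" for y k
    using that translate_in_subshift[OF sub] by (auto simp: tr)
  then have "shift ` (h a ` Y) = h a ` Y" by (rule shift_image_eq)
  moreover have binary: "h a ` Y \<subseteq> full_shift {0, 1}"
  proof
    fix x assume "x \<in> h a ` Y"
    then show "x \<in> full_shift {0, 1}" by (auto simp: full_shift_def h_def split: if_splits)
  qed
  ultimately have Z: "h a ` Y \<in> subshifts"
    unfolding subshifts_def by (intro CollectI conjI exI[of _ "{0, 1}"]) simp_all
  have "minimal_subshift (h a ` Y)"
    unfolding minimal_subshift_iff[OF Z]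
  proof (intro ballI allI)
    fix x n v assume "x \<in> h a ` Y" and "v \<in> language n (h a ` Y)"
    then obtain y y' i where y: "y \<in> Y" "x = h a y" "y' \<in> Y" "v = window (h a y') i n"
      unfolding language_def by blast
    obtain t where "window y t n = window y' i n"
      using minimal_occurs[OF Y(1) y(1) window_in_language[OF y(3)]] .
    then show "\<exists>t. window x t n = v" unfolding y(2,4) win by metis
  qed
  then show thesis using a binary by (rule that)
qed

section \<open>Refining a coding by a small perturbation\<close>

text \<open>If all gaps between consecutive occurrences of \<open>w\<close> carried the same word, the point would be
  periodic and \<open>Y\<close> finite.\<close>

lemma two_return_words_exist:
  assumes Y: "minimal_subshift Y" "infinite Y" and y: "y \<in> Y" and w: "w \<in> language (length w) Y"
  obtains t u t' u' where "occurs_at w y t" "occurs_at w y (t + int u)" "0 < u"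
    "\<And>j. 0 < j \<Longrightarrow> j < u \<Longrightarrow> \<not> occurs_at w y (t + int j)"
    "occurs_at w y t'" "occurs_at w y (t' + int u')" "0 < u'"
    "\<And>j. 0 < j \<Longrightarrow> j < u' \<Longrightarrow> \<not> occurs_at w y (t' + int j)"
    "window y t u \<noteq> window y t' u'"
proof -
  obtain R where R: "\<And>s. \<exists>t. s \<le> t \<and> t \<le> s + int R \<and> occurs_at w y t"
    using minimal_bounded_gaps[OF Y(1) w] y unfolding occurs_at_def by metis
  define N where "N t = (LEAST j. 0 < j \<and> occurs_at w y (t + int j))" for t
  have ex: "\<exists>j>0. occurs_at w y (t + int j)" for t
  proof -
    obtain s where "t + 1 \<le> s" "occurs_at w y s" using R[of "t + 1"] by blast
    then show ?thesis by (intro exI[of _ "nat (s - t)"]) simp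
  qed
  have N: "0 < N t" "occurs_at w y (t + int (N t))" for t
    using LeastI_ex[OF ex, of t] by (simp_all add: N_def)
  have N_least: "\<not> occurs_at w y (t + int j)" if "0 < j" "j < N t" for t j
    using not_less_Least[of j "\<lambda>j. 0 < j \<and> occurs_at w y (t + int j)"] that by (simp add: N_def)
  have "\<exists>t t'. occurs_at w y t \<and> occurs_at w y t' \<and> window y t (N t) \<noteq> window y t' (N t')"
  proof (rule ccontr)
    assume "\<not> ?thesis"
    then have same: "window y t (N t) = window y t' (N t')" if "occurs_at w y t" "occurs_at w y t'" for t t'
      using that by blast
    obtain t0 where t0: "occurs_at w y t0" using R by blast
    define p where "p = N t0"
    have p: "N t = p" if "occurs_at w y t" for t
      using arg_cong[OF same[OF that t0], of length] by (simp add: p_def)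
    have "y (i + int p) = y i" for i
    proof -
      have "\<exists>j. occurs_at w y (i - int j)"
      proof -
        obtain s where "s \<le> i" "occurs_at w y s" using R[of "i - int R"] by auto
        then show ?thesis by (intro exI[of _ "nat (i - s)"]) simp
      qed
      then have j: "occurs_at w y (i - int (LEAST j. occurs_at w y (i - int j)))" by (rule LeastI_ex)
      define t where "t = i - int (LEAST j. occurs_at w y (i - int j))"
      have t: "occurs_at w y t" using j by (simp add: t_def)
      define k where "k = nat (i - t)"
      have i: "i = t + int k" by (simp add: k_def t_def)
      have "k < p"
      proof (rule ccontr)
        assume "\<not> k < p"
        have "occurs_at w y (i - int (k - p))"
          using N(2)[of t] p[OF t] \<open>\<not> k < p\<close> i by (simp add: of_nat_diff)
        then have "(LEAST j. occurs_at w y (i - int j)) \<le> k - p" by (rule Least_le)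
        then show False using N(1)[of t] p[OF t] \<open>\<not> k < p\<close> by (simp add: k_def t_def)
      qed
      have tp: "occurs_at w y (t + int p)" using N(2)[of t] p[OF t] by simp
      have "window y (t + int p) p = window y t p" using same[OF tp t] p[OF t] p[OF tp] by simp
      then have "y (t + int p + int k) = y (t + int k)" using \<open>k < p\<close> unfolding window_eq_iff by blast
      then show ?thesis using i by (simp add: algebra_simps)
    qed
    moreover have "0 < p" using N(1)[of t0] by (simp add: p_def)
    ultimately have "finite Y" using finite_minimal_if_periodic[OF Y(1) y] by blast
    then show False using Y(2) by simp
  qed
  then obtain t t' where "occurs_at w y t" "occurs_at w y t'" "window y t (N t) \<noteq> window y t' (N t')" by blast
  then show thesis using that[OF _ N(2) N(1) N_least _ N(2) N(1) N_least] by blast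
qed

text \<open>The subshift \<open>Y'\<close> consists of the two blocks written along a binary subshift \<open>Z\<close>. A word of \<open>Y'\<close> of length \<open>n0\<close> lies
  in some \<open>r b @ w\<close>, which is a word of \<open>Y\<close>; conversely, \<open>w\<close> occurs in \<open>Y'\<close> and contains all words of \<open>Y\<close> of length
  \<open>n0\<close>. As \<open>w\<close> starts with the old marker, its return words are concatenations of old blocks.\<close>

lemma refined_coding_dense:
  assumes Y: "minimal_subshift Y" "infinite Y" and coding: "marked_coding A f l m Y"
  obtains Y' g l' m' \<sigma> where "minimal_subshift Y'" "infinite Y'" "language n Y' = language n Y"
    "marked_coding {0, 1} g l' m' Y'" "refines A f l m {0, 1} g m' \<sigma> Y'"
proof -
  interpret marked_coding A f l m Y by (rule coding)
  have sub: "Y \<in> subshifts" using Y(1) by (simp add: minimal_subshift_def)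
  \<comment> \<open>The two summands besides \<open>n\<close> cover the words inspected by the pair condition of \<open>refines\<close>.\<close>
  define n0 where "n0 = n + length m + 2 * l"
  obtain y0 where y0: "y0 \<in> Y" "window y0 0 (length m) = m"
    using language_at[OF sub marker_in_language] by blast
  obtain R where R: "\<And>u v. u \<in> language R Y \<Longrightarrow> v \<in> language n0 Y \<Longrightarrow> sublist v u"
    using minimal_iff_uniformly_recurrent[OF sub] Y(1) by blast
  define w where "w = window y0 0 (length m + R + n0)"
  have w: "w \<in> language (length w) Y" using window_in_language[OF y0(1)] by (simp add: w_def)
  have w_prefix: "prefix m w"
    using take_is_prefix[of "length m" w] y0(2) by (simp add: w_def take_window)
  have w_all: "sublist v w" if "v \<in> language n0 Y" for v
  proof -
    have "sublist v (window y0 (0 + int 0) R)" using R window_in_language[OF y0(1)] that by simp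
    moreover have "sublist (window y0 (0 + int 0) R) w" unfolding w_def by (rule sublist_window) simp
    ultimately show ?thesis using sublist_order.order_trans by blast
  qed
  obtain t u t' u' where ret:
    "occurs_at w y0 t" "occurs_at w y0 (t + int u)" "0 < u"
    "\<And>j. 0 < j \<Longrightarrow> j < u \<Longrightarrow> \<not> occurs_at w y0 (t + int j)"
    "occurs_at w y0 t'" "occurs_at w y0 (t' + int u')" "0 < u'"
    "\<And>j. 0 < j \<Longrightarrow> j < u' \<Longrightarrow> \<not> occurs_at w y0 (t' + int j)"
    "window y0 t u \<noteq> window y0 t' u'"
    using two_return_words_exist[OF Y y0(1) w] by blast
  define T where "T b = (if b then t' else t)" for b
  define U where "U b = (if b then u' else u)" for b
  define r where "r b = window y0 (T b) (U b)" for b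
  have TU: "occurs_at w y0 (T b)" "occurs_at w y0 (T b + int (U b))" "0 < U b"
    "\<And>j. 0 < j \<Longrightarrow> j < U b \<Longrightarrow> \<not> occurs_at w y0 (T b + int j)" for b
    using ret by (auto simp: T_def U_def)
  have rw: "r b @ w = window y0 (T b) (U b + length w)" for b
    using TU(2)[of b] by (simp add: r_def window_add occurs_at_def)
  have rw_lang: "r b @ w \<in> language (U b + length w) Y" for b
    unfolding rw by (rule window_in_language[OF y0(1)])
  interpret W: two_return_words w r
  proof
    fix b
    show "prefix w (r b @ w)"
      using TU(1)[of b] take_is_prefix[of "length w" "r b @ w"] unfolding rw
      by (simp add: take_window occurs_at_def)
    have "length (r b) = U b" by (simp add: r_def)
    then show "r b \<noteq> []" using TU(3)[of b] by auto
    fix j assume "0 < j" "j < length (r b)"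
    then show "take (length w) (drop j (r b @ w)) \<noteq> w"
      using TU(4)[of j b] unfolding rw by (simp add: take_drop_window occurs_at_def r_def)
  next
    show "inj r" using ret(9) by (auto simp: inj_def r_def T_def U_def)
  qed
  \<comment> \<open>The gap between two occurrences of the old marker is filled with old blocks.\<close>
  have "\<exists>\<rho>. set \<rho> \<subseteq> A \<and> r b = subst f \<rho>" for b
  proof -
    have m: "occurs_at m y0 (T b)" "occurs_at m y0 (T b + int (U b))"
      using TU(1,2)[of b] w_prefix occurs_at_prefix by blast+
    obtain z where z: "z \<in> decoded A f l m Y" "translate (T b) y0 = block_seq l f z"
      using decode[OF sub y0(1) m(1)] .
    have "int l dvd int (U b)" using occurs_iff[OF y0(1) m(1)] m(2) by simp
    then obtain d where d: "U b = d * l" by (metis dvd_def mult.commute of_nat_dvd_iff)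
    have "r b = window (translate (T b) y0) (0 * int l) (d * l)" by (simp add: r_def d)
    also have "\<dots> = subst f (window z 0 d)"
      unfolding z(2) using decodedD(1)[OF z(1)] length_block by (rule window_block_seq)
    finally show ?thesis
      using window_in_lists[OF decodedD(1)[OF z(1)], of 0 d] by (intro exI[of _ "window z 0 d"]) (auto simp: in_lists_conv_set)
  qed
  then obtain \<rho> where \<rho>: "\<And>b. set (\<rho> b) \<subseteq> A" "\<And>b. r b = subst f (\<rho> b)" by metis
  have \<rho>_ne: "\<rho> b \<noteq> []" for b using W.nonempty[of b] \<rho>(2)[of b] by auto
  define \<sigma> where "\<sigma> a = subst \<rho> (W.pattern a)" for a
  obtain Z where Z: "minimal_subshift Z" "infinite Z" "Z \<subseteq> full_shift {0, 1}"
    using binary_factor[OF Y] .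
  define Y' where "Y' = spread W.len W.block Z"
  have Y'_min: "minimal_subshift Y'"
    unfolding Y'_def using Z(1) _ Z(3) W.len_pos W.length_block by (rule spread_minimal) simp
  have Y'_inf: "infinite Y'"
    unfolding Y'_def using Z(2,3) W.length_block W.block_inj by (rule spread_infinite)
  have Y'_word: "\<exists>z\<in>Z. \<exists>i. v = window (block_seq W.len W.block z) i k" if v: "v \<in> language k Y'" for v k
  proof -
    obtain z i j where "z \<in> Z" "v = window (translate j (block_seq W.len W.block z)) i k"
      using v by (auto simp: language_def Y'_def spread_def)
    then show ?thesis unfolding window_translate by blast
  qed
  have x_lang: "window (block_seq W.len W.block z) i k \<in> language k Y'" if "z \<in> Z" for z i k
    using that unfolding Y'_def spread_def language_def by (metis (mono_tags, lifting) mem_Collect_eq translate_0)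
  have lang: "language n0 Y' = language n0 Y"
  proof (intro equalityI subsetI)
    \<comment> \<open>The window starts at offset \<open>s\<close> inside a block; completed to whole blocks it is spelled by return words.\<close>
    fix v assume "v \<in> language n0 Y'"
    then obtain z i where z: "z \<in> Z" "v = window (block_seq W.len W.block z) i n0" using Y'_word by blast
    define p s where "p = i div int W.len" and "s = nat (i mod int W.len)"
    have i: "i = p * int W.len + int s" and s: "s < W.len"
      using W.len_pos by (auto simp: p_def s_def nat_less_iff)
    have "n0 * 1 \<le> n0 * W.len" using W.len_pos by (intro mult_le_mono2) simp
    then have le: "s + n0 \<le> (n0 + 1) * W.len" using s by (simp add: add_mono)
    let ?s = "subst W.pattern (window z p (n0 + 1))"
    have v: "v = take n0 (drop s (subst r ?s))"
      unfolding z(2) i W.window_x[symmetric] using le by (simp only: take_drop_window)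
    have ls: "length (subst r ?s) = (n0 + 1) * W.len" unfolding W.window_x[symmetric] by simp
    then have "v = take n0 (drop s (subst r ?s @ w))" using v le by simp
    then obtain b where "sublist v (r b @ w)"
      using W.factor_local[of n0 s ?s] le ls by (auto simp: w_def)
    then obtain j where "v = window y0 j (length v)" unfolding rw using sublist_of_window by blast
    then show "v \<in> language n0 Y" using window_in_language[OF y0(1)] z(2) by (metis length_window)
  next
    fix v assume v: "v \<in> language n0 Y"
    then have lv: "length v = n0" by (auto simp: language_def)
    obtain z where z: "z \<in> Z" using Z(2) by fastforce
    have "sublist v W.marker"
      unfolding W.marker_def by (rule sublist_order.order_trans[OF w_all[OF v] sublist_append_leftI])
    moreover have "W.marker = window (block_seq W.len W.block z) 0 (length W.marker)"
      using W.marker_occurs_x[of z 0] by (simp add: occurs_at_def)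
    ultimately obtain j where "v = window (block_seq W.len W.block z) j n0"
      using sublist_of_window lv by metis
    then show "v \<in> language n0 Y'" using x_lang[OF z] by simp
  qed
  have coding': "marked_coding {0, 1} W.block W.len W.marker Y'"
  proof
    show "inj_on W.block {0, 1}" by (rule W.block_inj)
    fix v assume "v \<in> language (length W.marker + W.len) Y'"
    then obtain z i where z: "z \<in> Z"
      and v: "v = window (block_seq W.len W.block z) i (length W.marker + W.len)" using Y'_word by blast
    have occ: "take (length W.marker) (drop j v) = W.marker \<longleftrightarrow> int W.len dvd i + int j" if "j \<le> W.len" for j
      unfolding v using that W.marker_occurs_x[of z "i + int j"]
      by (simp add: take_drop_window occurs_at_def)
    have "drop W.len v = take (length W.marker) (drop W.len v)" by (simp add: v)
    then show "take (length W.marker) v = W.marker \<longleftrightarrow> drop W.len v = W.marker"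
      using occ[of 0] occ[of W.len] by simp
    assume m: "take (length W.marker) v = W.marker"
    then have dvd: "int W.len dvd i" using occ[of 0] by simp
    show "take (length W.marker) (drop j v) \<noteq> W.marker" if "0 < j" "j < W.len" for j
      using occ[of j] dvd that by (auto simp: dvd_add_right_iff dest: zdvd_imp_le)
    obtain p where p: "i = p * int W.len" using dvd by (metis dvd_def mult.commute)
    have "take W.len v = window (block_seq W.len W.block z) (p * int W.len) (1 * W.len)"
      by (simp add: v p take_window)
    also have "\<dots> = W.block (z p)"
      using window_block_seq[of z "{0, 1}" W.block W.len p 1] z Z(3) by (simp add: window_def subset_iff)
    finally have "take W.len v = W.block (z p)" .
    moreover have "z p \<in> {0, 1}" using z Z(3) unfolding full_shift_def by blast
    ultimately show "take W.len v \<in> W.block ` {0, 1}" by (simp only: imageI)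
  next
    fix a :: int assume a: "a \<in> {0, 1}"
    have "\<exists>z\<in>Z. \<exists>p. z p = a"
    proof (rule ccontr)
      assume "\<not> ?thesis"
      then have "Z \<subseteq> {\<lambda>_. 1 - a}" using a Z(3) by (fastforce simp: full_shift_def)
      then show False using Z(2) finite_subset by blast
    qed
    then obtain z p where z: "z \<in> Z" "z p = a" by blast
    let ?v = "window (block_seq W.len W.block z) (p * int W.len) (length W.marker + W.len)"
    have "window (block_seq W.len W.block z) (p * int W.len) (1 * W.len) = W.block a"
      using window_block_seq[of z "{0, 1}" W.block W.len p 1] z Z(3) by (simp add: window_def subset_iff)
    moreover have "occurs_at W.marker (block_seq W.len W.block z) (p * int W.len)"
      by (simp add: W.marker_occurs_x)
    ultimately have "take (length W.marker) ?v = W.marker \<and> take W.len ?v = W.block a"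
      by (simp add: take_window occurs_at_def)
    then show "\<exists>v\<in>language (length W.marker + W.len) Y'.
        take (length W.marker) v = W.marker \<and> take W.len v = W.block a"
      using x_lang[OF z(1)] by blast
  qed (use W.len_pos in auto)
  have "refines A f l m {0, 1} W.block W.marker \<sigma> Y'"
    unfolding refines_def
  proof (intro conjI ballI impI)
    show "prefix m W.marker"
      using w_prefix W.prefix_w prefix_order.order_trans unfolding W.marker_def by blast
  next
    fix a :: int
    show \<sigma>A: "\<sigma> a \<in> lists A" using \<rho>(1) by (auto simp: \<sigma>_def in_lists_conv_set)
    show \<sigma>_block: "W.block a = subst f (\<sigma> a)"
      unfolding W.block_def \<sigma>_def subst_subst by (rule arg_cong[OF ext[OF \<rho>(2)]])
    fix b c v
    assume b: "b \<in> A" and c: "c \<in> A" and v: "v \<in> language (length m + 2 * l) Y'"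
      and mv: "take (length m) v = m \<and> take (2 * l) v = f b @ f c"
    have "language (length m + 2 * l) Y' = language (length m + 2 * l) Y"
      using language_eq_shorter[OF lang] by (simp add: n0_def)
    then have vY: "v \<in> language (length m + 2 * l) Y" using v by simp
    then obtain v' where v': "v' \<in> language n0 Y" "v = take (length m + 2 * l) v'"
      using language_shorter[of "length m + 2 * l" n0 Y] by (auto simp: n0_def)
    \<comment> \<open>The pair is found in \<open>w\<close> at a cut of the old coding, and each new block starts with \<open>w\<close>.\<close>
    obtain x1 x2 where "w = x1 @ v' @ x2" using w_all[OF v'(1)] by (auto simp: sublist_def)
    moreover have lv: "length v = length m + 2 * l" using v by (auto simp: language_def)
    ultimately obtain x3 where wx: "w = x1 @ v @ x3" using v'(2) by (metis append.assoc append_take_drop_id)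
    have "m = take (length m) (drop (length x1) w)" using wx mv by (simp add: lv)
    also have "\<dots> = window y0 (int (length x1)) (length m)"
      using arg_cong[OF wx, of length] lv unfolding w_def by (subst take_drop_window) auto
    finally have "occurs_at m y0 (int (length x1))" by (simp add: occurs_at_def)
    then have "int l dvd int (length x1)" using occurs_iff[OF y0(1), of 0] y0(2) by (simp add: occurs_at_def)
    then obtain d where d: "length x1 = d * l" by (metis dvd_def mult.commute of_nat_dvd_iff)
    obtain x4 where "W.block a = w @ x4" using W.w_prefix_block by (auto simp: prefix_def)
    then have "subst f (\<sigma> a) = x1 @ v @ x3 @ x4" using \<sigma>_block wx by simp
    then have "take (2 * l) (drop (d * l) (subst f (\<sigma> a))) = f b @ f c"
      using mv lv by (simp add: d[symmetric])
    moreover have len: "x \<in> set (\<sigma> a) \<Longrightarrow> length (f x) = l" for x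
      using \<sigma>A length_block by (auto simp: in_lists_conv_set)
    ultimately have "subst f (take 2 (drop d (\<sigma> a))) = subst f [b, c]"
      using take_subst[of "drop d (\<sigma> a)" f l 2] drop_subst[of "\<sigma> a" f l d] by (simp add: in_set_dropD)
    moreover have "set (take 2 (drop d (\<sigma> a))) \<subseteq> A" "set [b, c] \<subseteq> A"
      using \<sigma>A b c by (auto simp: in_lists_conv_set dest!: in_set_takeD in_set_dropD)
    ultimately have "take 2 (drop d (\<sigma> a)) = [b, c]"
      using subst_inject[of f A l] inj_block length_block l_pos by blast
    then show "sublist [b, c] (\<sigma> a)"
      by (metis append_take_drop_id sublist_appendI)
  next
    fix a b :: int
    have hd: "hd (\<sigma> a) = hd (\<rho> False)" for a
      using \<rho>_ne by (simp add: \<sigma>_def W.pattern_def W.K_def numeral_3_eq_3)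
    have last: "last (\<sigma> a) = last (\<rho> True)" for a
      using \<rho>_ne by (simp add: \<sigma>_def W.pattern_def)
    show "hd (\<sigma> a) = hd (\<sigma> b)" "last (\<sigma> a) = last (\<sigma> b)" using hd last by simp_all
  qed
  moreover have "language n Y' = language n Y"
    using language_eq_shorter[OF lang] by (simp add: n0_def)
  ultimately show thesis using that Y'_min Y'_inf coding' by blast
qed

section \<open>Genericity\<close>

lemma marked_coding_cong_blocks:
  assumes "\<forall>a\<in>A. f a = g a"
  shows "marked_coding A f l m Y \<longleftrightarrow> marked_coding A g l m Y"
proof -
  have "inj_on f A \<longleftrightarrow> inj_on g A" "f ` A = g ` A" using assms by (auto simp: inj_on_def)
  then show ?thesis unfolding marked_coding_def using assms by simp
qed

lemma refines_cong_blocks: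
  assumes "\<forall>a\<in>A'. f' a = g' a"
  shows "refines A f l m A' f' m' \<sigma> Y \<longleftrightarrow> refines A f l m A' g' m' \<sigma> Y"
  unfolding refines_def using assms by simp

text \<open>Blocks of length one with the empty marker: the coding from which the refinements start.\<close>

lemma letters_coding:
  assumes sub: "Y \<in> subshifts" and ne: "Y \<noteq> {}"
  defines "A \<equiv> {a. [a] \<in> language 1 Y}"
  shows "marked_coding A (\<lambda>a. [a]) 1 [] Y" and "decoded A (\<lambda>a. [a]) 1 [] Y = Y"
proof -
  have letter: "y i \<in> A" if "y \<in> Y" for y i
    using window_in_language[OF that, of i 1] by (simp add: A_def window_def)
  show "marked_coding A (\<lambda>a. [a]) 1 [] Y"
  proof
    show "finite A"
      unfolding A_def using finite_language[OF sub, of 1] finite_vimageI[of "language 1 Y" "\<lambda>a. [a]"]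
      by (simp add: vimage_def inj_def)
    show "A \<noteq> {}" using ne letter by blast
    fix v assume v: "v \<in> language (length ([] :: int list) + 1) Y"
    then have "v \<in> language 1 Y" "length v = 1" by (auto simp: language_def)
    then show "take 1 v \<in> (\<lambda>a. [a]) ` A"
      by (cases v) (auto simp: A_def)
    show "take (length []) v = [] \<longleftrightarrow> drop 1 v = []" using \<open>length v = 1\<close> by simp
  next
    fix a assume "a \<in> A"
    then show "\<exists>w\<in>language (length ([] :: int list) + 1) Y. take (length []) w = [] \<and> take 1 w = [a]"
      by (intro bexI[of _ "[a]"]) (auto simp: A_def)
  qed (auto simp: inj_on_def)
  have "block_seq 1 (\<lambda>a. [a]) z = z" for z by (simp add: block_seq_def fun_eq_iff)
  then show "decoded A (\<lambda>a. [a]) 1 [] Y = Y"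
    using letter by (auto simp: decoded_def occurs_at_def full_shift_def window_def)
qed

text \<open>A coding whose blocks are listed in a finite table, so that there are only countably many; the other
  components are the block length and the marker.\<close>

type_synonym code = "(int \<times> int list) list \<times> nat \<times> int list"

definition letters :: "code \<Rightarrow> int set" where
  "letters c = fst ` set (fst c)"

definition word_of :: "code \<Rightarrow> int \<Rightarrow> int list" where
  "word_of c a = the (map_of (fst c) a)"

abbreviation codes :: "code \<Rightarrow> (int \<Rightarrow> int) set \<Rightarrow> bool" where
  "codes c Y \<equiv> marked_coding (letters c) (word_of c) (fst (snd c)) (snd (snd c)) Y"

abbreviation code_refines :: "code \<Rightarrow> code \<Rightarrow> (int \<Rightarrow> int list) \<Rightarrow> (int \<Rightarrow> int) set \<Rightarrow> bool" where
  "code_refines c c' \<sigma> Y \<equiv>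
     refines (letters c) (word_of c) (fst (snd c)) (snd (snd c)) (letters c') (word_of c') (snd (snd c')) \<sigma> Y"

lemma code_exists:
  assumes "finite A"
  obtains c where "letters c = A" "\<forall>a\<in>A. word_of c a = f a" "snd c = (l, m)"
proof -
  let ?c = "(map (\<lambda>a. (a, f a)) (sorted_list_of_set A), l, m)"
  have "letters ?c = A" using assms by (simp add: letters_def image_image)
  moreover have "word_of ?c a = f a" if "a \<in> A" for a
    using that assms by (simp add: word_of_def map_of_map_restrict)
  ultimately show thesis using that by simp
qed

text \<open>The implication makes the set dense: a subshift without the coding belongs to it, and one with the coding
  can be perturbed into it.\<close>

definition refinable :: "code \<Rightarrow> (int \<Rightarrow> int) set set" where
  "refinable c = {Y \<in> infinite_minimal_subshifts. codes c Y \<longrightarrow>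
     (\<exists>c' \<sigma>. codes c' Y \<and> code_refines c c' \<sigma> Y \<and> card (letters c') \<le> 2)}"

lemma open_refinable: "openin infinite_minimal_space (refinable c)"
  unfolding openin_infinite_minimal_space
proof (intro conjI ballI)
  obtain P l m where c: "c = (P, l, m)" by (cases c)
  fix Y assume Y: "Y \<in> refinable c"
  show "\<exists>n. \<forall>Y'\<in>infinite_minimal_subshifts. language n Y' = language n Y \<longrightarrow> Y' \<in> refinable c"
  proof (cases "codes c Y")
    case False
    have "Y' \<in> refinable c"
      if "Y' \<in> infinite_minimal_subshifts" "language (length m + l) Y' = language (length m + l) Y" for Y'
    proof -
      have "\<not> codes c Y'" using False marked_coding_cong_language[OF that(2)] by (simp add: c)
      then show ?thesis using that(1) unfolding refinable_def by blast
    qed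
    then show ?thesis by blast
  next
    case True
    then obtain c' \<sigma> where c': "codes c' Y" "code_refines c c' \<sigma> Y" "card (letters c') \<le> 2"
      using Y by (auto simp: refinable_def)
    obtain P' l' m' where c'_eq: "c' = (P', l', m')" by (cases c')
    let ?n = "length m' + l' + (length m + 2 * l)"
    have "Y' \<in> refinable c" if Y': "Y' \<in> infinite_minimal_subshifts" "language ?n Y' = language ?n Y" for Y'
    proof -
      have L: "language (length m' + l') Y' = language (length m' + l') Y"
        "language (length m + 2 * l) Y' = language (length m + 2 * l) Y"
        by (rule language_eq_shorter[OF Y'(2)], simp)+
      have "codes c' Y'" "code_refines c c' \<sigma> Y'"
        using c'(1,2) marked_coding_cong_language[OF L(1)] refines_cong_language[OF L(2)]
        unfolding c c'_eq fst_conv snd_conv by blast+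
      then show ?thesis using Y'(1) c'(3) unfolding refinable_def by blast
    qed
    then show ?thesis by blast
  qed
qed (auto simp: refinable_def)

lemma dense_refinable: "infinite_minimal_space closure_of (refinable c) = topspace infinite_minimal_space"
  unfolding dense_intersects_open
proof (intro allI impI)
  fix T assume T: "openin infinite_minimal_space T \<and> T \<noteq> {}"
  then obtain Y where Y: "Y \<in> T" by blast
  then obtain n where n: "\<And>Y'. Y' \<in> infinite_minimal_subshifts \<Longrightarrow> language n Y' = language n Y \<Longrightarrow> Y' \<in> T"
    using T unfolding openin_infinite_minimal_space by blast
  have Ym: "minimal_subshift Y" "infinite Y"
    using T Y unfolding openin_infinite_minimal_space infinite_minimal_subshifts_def by blast+
  show "refinable c \<inter> T \<noteq> {}"
  proof (cases "codes c Y")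
    case False
    then have "Y \<in> refinable c" using Ym by (simp add: refinable_def infinite_minimal_subshifts_def)
    then show ?thesis using Y by blast
  next
    case True
    obtain Y' g l' m' \<sigma> where Y': "minimal_subshift Y'" "infinite Y'" "language n Y' = language n Y"
      and coding: "marked_coding {0, 1} g l' m' Y'"
      and ref: "refines (letters c) (word_of c) (fst (snd c)) (snd (snd c)) {0, 1} g m' \<sigma> Y'"
      by (rule refined_coding_dense[OF Ym True])
    obtain c' where c': "letters c' = {0, 1}" "\<forall>a\<in>{0, 1}. word_of c' a = g a" "snd c' = (l', m')"
      by (rule code_exists[of "{0, 1}" g l' m']) simp_all
    have "codes c' Y'" using coding c' marked_coding_cong_blocks[OF c'(2)] by simp
    moreover have "code_refines c c' \<sigma> Y'" using ref c' refines_cong_blocks[OF c'(2)] by simp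
    moreover have "card (letters c') \<le> 2" using c'(1) by simp
    moreover have "Y' \<in> infinite_minimal_subshifts" using Y' by (simp add: infinite_minimal_subshifts_def)
    ultimately have "Y' \<in> refinable c" "Y' \<in> T" using n Y'(3) unfolding refinable_def by blast+
    then show ?thesis by blast
  qed
qed

text \<open>Refining the coding by letters over and over, by dependent choice, gives a chain of codings.\<close>

lemma strong_toeplitz_if_refinable:
  assumes Y: "\<And>c. Y \<in> refinable c"
  shows "strong_toeplitz 2 Y"
proof -
  have min: "minimal_subshift Y" "infinite Y" "Y \<in> subshifts"
    using Y by (auto simp: refinable_def infinite_minimal_subshifts_def minimal_subshift_def)
  let ?A = "{a. [a] \<in> language 1 Y}"
  have ne: "Y \<noteq> {}" using min(2) by auto
  note base = letters_coding[OF min(3) ne]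
  obtain c0 where c0: "letters c0 = ?A" "\<forall>a\<in>?A. word_of c0 a = [a]" "snd c0 = (1, [])"
    by (rule code_exists[OF marked_coding.finite_alphabet[OF base(1)], of "\<lambda>a. [a]" 1 "[]"])
  have codes0: "codes c0 Y"
    using base(1) c0 marked_coding_cong_blocks[OF c0(2)] by simp
  have "block_seq 1 (word_of c0) z = block_seq 1 (\<lambda>a. [a]) z" if "z \<in> full_shift ?A" for z
    using that by (rule block_seq_cong) (rule c0(2)[rule_format])
  then have "decoded ?A (word_of c0) 1 [] Y = decoded ?A (\<lambda>a. [a]) 1 [] Y"
    unfolding decoded_def by (intro Collect_cong) (simp cong: conj_cong)
  then have dec0: "decoded (letters c0) (word_of c0) 1 [] Y = Y" using base(2) c0(1) by simp
  define R where "R c c' \<longleftrightarrow> (\<exists>\<sigma>. code_refines c c' \<sigma> Y \<and> card (letters c') \<le> 2)" for c c'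
  have "\<exists>c. \<forall>n. (codes (c n) Y \<and> (n = 0 \<longrightarrow> c n = c0)) \<and> R (c n) (c (Suc n))"
  proof (rule dependent_nat_choice)
    show "\<exists>c. codes c Y \<and> (0 = (0 :: nat) \<longrightarrow> c = c0)" using codes0 by blast
    fix c and n :: nat assume "codes c Y \<and> (n = 0 \<longrightarrow> c = c0)"
    then show "\<exists>c'. (codes c' Y \<and> (Suc n = 0 \<longrightarrow> c' = c0)) \<and> R c c'"
      using Y[of c] unfolding refinable_def R_def by blast
  qed
  then obtain c where c: "\<And>n. codes (c n) Y" "c 0 = c0" "\<And>n. R (c n) (c (Suc n))" by blast
  then obtain \<sigma> where \<sigma>: "\<And>n. code_refines (c n) (c (Suc n)) (\<sigma> n) Y" "\<And>n. card (letters (c (Suc n))) \<le> 2"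
    unfolding R_def by metis
  interpret coding_chain Y "\<lambda>n. letters (c n)" "\<lambda>n. word_of (c n)" "\<lambda>n. fst (snd (c n))" "\<lambda>n. snd (snd (c n))" \<sigma>
    by (rule coding_chain.intro) (rule min(1) c(1) \<sigma>(1))+
  show ?thesis
    by (rule strong_toeplitz_if_rank) (use dec0 c0(3) c(2) \<sigma>(2) in simp_all)
qed

theorem theorem4p9:
  shows "generic_in infinite_minimal_space {X \<in> infinite_minimal_subshifts. strong_toeplitz 2 X}"
proof -
  let ?G = "\<Inter> (range refinable)"
  have cl: "infinite_minimal_space closure_of ?G = topspace infinite_minimal_space"
    by (rule infinite_minimal_space_Baire) (auto simp: open_refinable dense_refinable)
  have sub: "?G \<subseteq> infinite_minimal_subshifts" by (auto simp: refinable_def)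
  have "(countable intersection_of openin infinite_minimal_space) ?G"
    unfolding intersection_of_def
    by (intro exI[of _ "range refinable"]) (auto simp: open_refinable)
  then have gdelta: "gdelta_in infinite_minimal_space ?G"
    using sub by (simp add: gdelta_in_alt topspace_infinite_minimal_space)
  have "?G \<subseteq> {X \<in> infinite_minimal_subshifts. strong_toeplitz 2 X}"
    using sub strong_toeplitz_if_refinable by blast
  then show ?thesis
    using gdelta cl by (auto simp: generic_in_def topspace_infinite_minimal_space)
qed

end
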